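(* Let $\Omega\subset\mathbb{R}^N$ be an open set, $N=N_1+\dots+N_k\ge 3$, and let $\lambda=(\lambda_1,\dots,\lambda_k)$, $\alpha_{ij}$, $\sigma_i$, $Q$, $\nabla_\lambda$ and $[[\cdot]]_\lambda$ be as in the context. Let $\|\cdot\|_\lambda$ be either of the two homogeneous norms $$\|x\|_\lambda=\left(\sum_{j=1}^k|x^{(j)}|^{2\prod_{i\ne j}\sigma_i}\right)^{\frac{1}{2\prod_{i=1}^k\sigma_i}}\quad\text{or}\quad\|x\|_\lambda=\left(\sum_{j=1}^k(\sigma_j|x^{(j)}|)^{2\prod_{i\ne j}\sigma_i}\right)^{\frac{1}{2\prod_{i=1}^k\sigma_i}}.$$ Let $p>1$ and $\mu_1,\dots,\mu_k,s,t\in\mathbb{R}$ be such that $s+t<N_1+\mu_1$ and $$-p\min\{\alpha_{1i},\dots,\alpha_{ki},1\}+s+\frac{t}{\sigma_i}<N_i+\mu_i,\qquad i=1,\dots,k.$$ Put $$\psi(x)=\frac{\prod_{i=1}^k|x^{(i)}|^{\,\mu_i-p\sum_{j=1}^k\alpha_{ji}}}{\|x\|_\lambda^t\,[[x]]_\lambda^{\,s-p(1+\sum_{i=1}^k(\sigma_i-1))}}.$$ Then for every $u\in\mathring{W}_\lambda^{1,p}(\Omega,\psi)$, $$\left(\frac{Q-s-t+\sum_{i=1}^k\sigma_i\mu_i}{p}\right)^p\int_\Omega\frac{\prod_{i=1}^k|x^{(i)}|^{\mu_i}}{\|x\|_\lambda^t\,[[x]]_\lambda^s}|u(x)|^p\,dx\le\int_\Omega\psi(x)\,|\nabla_\lambda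 u(x)|^p\,dx.$$ In particular, for $s=0$, $\mu_1=\dots=\mu_k=0$ and $t=p$ (when these values satisfy $s+t<N_1+\mu_1$ and $-p\min\{\alpha_{1i},\dots,\alpha_{ki},1\}+s+\frac{t}{\sigma_i}<N_i+\mu_i$ for $i=1,\dots,k$, and for $u\in\mathring{W}_\lambda^{1,p}(\Omega,\psi)$ with the corresponding $\psi$), $$\left(\frac{Q-p}{p}\right)^p\int_\Omega\frac{|u(x)|^p}{\|x\|_\lambda^p}\,dx\le\int_\Omega\frac{[[x]]_\lambda^{\,p(1+\sum_{i=1}^k(\sigma_i-1))}}{\|x\|_\lambda^p\prod_{j=1}^k\lambda_j(x)^p}|\nabla_\lambda u(x)|^p\,dx.$$
   Context: Split $\mathbb{R}^N=\mathbb{R}^{N_1}\times\dots\times\mathbb{R}^{N_k}$ and write $x=(x^{(1)},\dots,x^{(k)})$ with $x^{(i)}=(x^{(i)}_1,\dots,x^{(i)}_{N_i})\in\mathbb{R}^{N_i}$; $|\cdot|$ is the Euclidean norm. Let $\alpha_{ij}\ge 0$ for $1\le j<i\le k$ be real constants and set $\alpha_{ij}=0$ for $j\ge i$ (so in particular $\alpha_{1j}=0$ for all $j$). Define $$\lambda_i(x)=\prod_{j=1}^k|x^{(j)}|^{\alpha_{ij}},\qquad i=1,\dots,k,$$ so $\lambda_1\equiv1$; the functions $\lambda_i$ are assumed pairwise different. Define $\sigma_1=1$ and $\sigma_i=1+\sum_{j=1}^{i-1}\alpha_{ij}\sigma_j$ for $i=2,\dots,k$, and the homogeneous dimension $Q=\sigma_1N_1+\dots+\sigma_kN_k$.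 For a $C^1$ function $u$, $\nabla_\lambda u=(\lambda_1\nabla_{x^{(1)}}u,\dots,\lambda_k\nabla_{x^{(k)}}u)$, where $\nabla_{x^{(i)}}$ is the gradient in the variables $x^{(i)}$. The homogeneous norm $[[\cdot]]_\lambda$ is $$[[x]]_\lambda=\left(\sum_{j=1}^k\Big(\prod_{i\ne j}\lambda_i(x)^2\Big)\sigma_j^2|x^{(j)}|^2\right)^{\frac{1}{2(1+\sum_{i=1}^k(\sigma_i-1))}},\qquad x\in\mathbb{R}^N.$$ For $\psi\in L^1_{loc}(\Omega)$ with $\psi>0$ a.e. in $\Omega$, $\mathring{W}_\lambda^{1,p}(\Omega,\psi)$ denotes the closure of $C_0^1(\Omega)$ (compactly supported $C^1$ functions on $\Omega$) with respect to the norm $\left(\int_\Omega|\nabla_\lambda u(x)|^p\psi(x)\,dx\right)^{1/p}$.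
   Formalization: The main inequality is proved under the added condition Q − s − t + Σσ_iμ_i ≥ 0; for a negative value the real power is in general undefined, and for p = 2 the inequality can fail although the listed conditions hold. *)

theory Defs
  imports "HOL-Analysis.Analysis"
begin

text \<open>
  The splitting of \<open>\<real>\<^sup>N\<close> into blocks is given by a map \<open>b :: 'n \<Rightarrow> nat\<close> on the coordinate indices:
  coordinate \<open>m\<close> belongs to the block \<open>x\<^sup>(\<^sup>i\<^sup>)\<close> iff \<open>b m = i\<close>. The blocks are numbered \<open>1, \<dots>, k\<close>, and
  \<open>range b = {1..k}\<close> says that all of them have positive dimension.
\<close>

definition block_dim :: "('n::finite \<Rightarrow> nat) \<Rightarrow> nat \<Rightarrow> nat" where
  "block_dim b i = card {m. b m = i}"

definition block_norm :: "('n::finite \<Rightarrow> nat) \<Rightarrow> nat \<Rightarrow> real ^ 'n \<Rightarrow> real" where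
  "block_norm b i x = L2_set (\<lambda>m. x $ m) {m. b m = i}"

text \<open>
  Power of a nonnegative base with \<open>0\<^sup>0 = 1\<close>; the library has \<open>0 powr 0 = 0\<close>, which would
  destroy \<open>\<lambda>\<^sub>1 \<equiv> 1\<close> at points with a vanishing block.
\<close>

definition rpow :: "real \<Rightarrow> real \<Rightarrow> real" where
  "rpow x a = (if a = 0 then 1 else x powr a)"

definition lam :: "('n::finite \<Rightarrow> nat) \<Rightarrow> nat \<Rightarrow> (nat \<Rightarrow> nat \<Rightarrow> real) \<Rightarrow> nat \<Rightarrow> real ^ 'n \<Rightarrow> real" where
  "lam b k \<alpha> i x = (\<Prod>j=1..k. rpow (block_norm b j x) (\<alpha> i j))"

definition lam_system :: "('n::finite \<Rightarrow> nat) \<Rightarrow> nat \<Rightarrow> (nat \<Rightarrow> nat \<Rightarrow> real) \<Rightarrow> bool" where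
  "lam_system b k \<alpha> \<longleftrightarrow>
     range b = {1..k} \<and>
     (\<forall>i\<in>{1..k}. \<forall>j\<in>{1..k}. (j < i \<longrightarrow> 0 \<le> \<alpha> i j) \<and> (i \<le> j \<longrightarrow> \<alpha> i j = 0)) \<and>
     inj_on (lam b k \<alpha>) {1..k}"

fun sig :: "(nat \<Rightarrow> nat \<Rightarrow> real) \<Rightarrow> nat \<Rightarrow> real" where
  "sig \<alpha> i = 1 + (\<Sum>j\<in>{1..<i}. \<alpha> i j * sig \<alpha> j)"

declare sig.simps [simp del]

definition hom_dim :: "('n::finite \<Rightarrow> nat) \<Rightarrow> nat \<Rightarrow> (nat \<Rightarrow> nat \<Rightarrow> real) \<Rightarrow> real" where
  "hom_dim b k \<alpha> = (\<Sum>i=1..k. sig \<alpha> i * real (block_dim b i))"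

text \<open>The recurring exponent \<open>1 + \<Sum>(\<sigma>\<^sub>i - 1)\<close>.\<close>

definition lam_deg :: "nat \<Rightarrow> (nat \<Rightarrow> nat \<Rightarrow> real) \<Rightarrow> real" where
  "lam_deg k \<alpha> = 1 + (\<Sum>i=1..k. sig \<alpha> i - 1)"

definition bracket_norm ::
  "('n::finite \<Rightarrow> nat) \<Rightarrow> nat \<Rightarrow> (nat \<Rightarrow> nat \<Rightarrow> real) \<Rightarrow> real ^ 'n \<Rightarrow> real" where
  "bracket_norm b k \<alpha> x =
     (\<Sum>j=1..k. (\<Prod>i\<in>{1..k} - {j}. (lam b k \<alpha> i x)\<^sup>2) * (sig \<alpha> j)\<^sup>2 * (block_norm b j x)\<^sup>2)
       powr (1 / (2 * lam_deg k \<alpha>))"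

definition hnorm1 ::
  "('n::finite \<Rightarrow> nat) \<Rightarrow> nat \<Rightarrow> (nat \<Rightarrow> nat \<Rightarrow> real) \<Rightarrow> real ^ 'n \<Rightarrow> real" where
  "hnorm1 b k \<alpha> x =
     (\<Sum>j=1..k. block_norm b j x powr (2 * (\<Prod>i\<in>{1..k} - {j}. sig \<alpha> i)))
       powr (1 / (2 * (\<Prod>i=1..k. sig \<alpha> i)))"

definition hnorm2 ::
  "('n::finite \<Rightarrow> nat) \<Rightarrow> nat \<Rightarrow> (nat \<Rightarrow> nat \<Rightarrow> real) \<Rightarrow> real ^ 'n \<Rightarrow> real" where
  "hnorm2 b k \<alpha> x =
     (\<Sum>j=1..k. (sig \<alpha> j * block_norm b j x) powr (2 * (\<Prod>i\<in>{1..k} - {j}. sig \<alpha> i)))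
       powr (1 / (2 * (\<Prod>i=1..k. sig \<alpha> i)))"

definition gradient :: "(real ^ 'n::finite \<Rightarrow> real) \<Rightarrow> real ^ 'n \<Rightarrow> real ^ 'n" where
  "gradient u x = (\<chi> m. frechet_derivative u (at x) (axis m 1))"

definition lam_gradient ::
  "('n::finite \<Rightarrow> nat) \<Rightarrow> nat \<Rightarrow> (nat \<Rightarrow> nat \<Rightarrow> real) \<Rightarrow> (real ^ 'n \<Rightarrow> real) \<Rightarrow> real ^ 'n \<Rightarrow> real ^ 'n" where
  "lam_gradient b k \<alpha> u x = (\<chi> m. lam b k \<alpha> (b m) x * gradient u x $ m)"

text \<open>Elements of \<open>C\<^sub>0\<^sup>1(\<Omega>)\<close> are represented by their extensions by zero to the whole space.\<close>

definition C01 :: "(real ^ 'n::finite) set \<Rightarrow> (real ^ 'n \<Rightarrow> real) set" where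
  "C01 \<Omega> = {\<phi>. \<phi> differentiable_on UNIV \<and> continuous_on UNIV (gradient \<phi>) \<and>
                 compact (closure {x. \<phi> x \<noteq> 0}) \<and> closure {x. \<phi> x \<noteq> 0} \<subseteq> \<Omega>}"

text \<open>The \<open>p\<close>-th power of the norm of \<open>G\<close> in \<open>L\<^sup>p(\<Omega>, \<psi> dx)\<close>.\<close>

definition Lp_energy ::
  "(real ^ 'n::finite) set \<Rightarrow> real \<Rightarrow> (real ^ 'n \<Rightarrow> real) \<Rightarrow> (real ^ 'n \<Rightarrow> real ^ 'n) \<Rightarrow> ennreal" where
  "Lp_energy \<Omega> p \<psi> G = (\<integral>\<^sup>+x. ennreal (\<psi> x * norm (G x) powr p) \<partial>lebesgue_on \<Omega>)"

text \<open>
  An element of the closure of \<open>C\<^sub>0\<^sup>1(\<Omega>)\<close> is given by a sequence \<open>\<phi>\<^sub>n\<close> in \<open>C\<^sub>0\<^sup>1(\<Omega>)\<close> that is Cauchy for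
  \<open>(\<integral>\<psi>|\<nabla>\<^sub>\<lambda>\<phi>|\<^sup>p)\<^sup>1\<^sup>/\<^sup>p\<close>; it is identified with the function \<open>u\<close> to which \<open>\<phi>\<^sub>n\<close> (after passing to a
  subsequence) converges almost everywhere, and its \<open>\<lambda>\<close>-gradient is the limit \<open>G\<close> of
  \<open>\<nabla>\<^sub>\<lambda>\<phi>\<^sub>n\<close> in \<open>L\<^sup>p(\<Omega>, \<psi> dx)\<close>. The finiteness condition holds for all of \<open>C\<^sub>0\<^sup>1(\<Omega>)\<close> when \<open>\<psi>\<close> is locally
  integrable on \<open>\<Omega>\<close>; including it makes sense of the space without that restriction.
\<close>

definition has_W0_gradient ::
  "('n::finite \<Rightarrow> nat) \<Rightarrow> nat \<Rightarrow> (nat \<Rightarrow> nat \<Rightarrow> real) \<Rightarrow> (real ^ 'n) set \<Rightarrow> real \<Rightarrow>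
   (real ^ 'n \<Rightarrow> real) \<Rightarrow> (real ^ 'n \<Rightarrow> real) \<Rightarrow> (real ^ 'n \<Rightarrow> real ^ 'n) \<Rightarrow> bool" where
  "has_W0_gradient b k \<alpha> \<Omega> p \<psi> u G \<longleftrightarrow>
     G \<in> borel_measurable (lebesgue_on \<Omega>) \<and>
     (\<exists>\<phi>. (\<forall>n::nat. \<phi> n \<in> C01 \<Omega> \<and> Lp_energy \<Omega> p \<psi> (lam_gradient b k \<alpha> (\<phi> n)) < \<infinity>) \<and>
          (AE x in lebesgue_on \<Omega>. (\<lambda>n. \<phi> n x) \<longlonglongrightarrow> u x) \<and>
          (\<lambda>n. Lp_energy \<Omega> p \<psi> (\<lambda>x. lam_gradient b k \<alpha> (\<phi> n) x - G x)) \<longlonglongrightarrow> 0)"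

definition W0 ::
  "('n::finite \<Rightarrow> nat) \<Rightarrow> nat \<Rightarrow> (nat \<Rightarrow> nat \<Rightarrow> real) \<Rightarrow> (real ^ 'n) set \<Rightarrow> real \<Rightarrow>
   (real ^ 'n \<Rightarrow> real) \<Rightarrow> (real ^ 'n \<Rightarrow> real) set" where
  "W0 b k \<alpha> \<Omega> p \<psi> = {u. \<exists>G. has_W0_gradient b k \<alpha> \<Omega> p \<psi> u G}"

text \<open>In the following, \<open>nrm\<close> stands for the homogeneous norm \<open>\<parallel>\<cdot>\<parallel>\<^sub>\<lambda>\<close>.\<close>

definition hardy_weight ::
  "('n::finite \<Rightarrow> nat) \<Rightarrow> nat \<Rightarrow> (nat \<Rightarrow> nat \<Rightarrow> real) \<Rightarrow> (real ^ 'n \<Rightarrow> real) \<Rightarrow>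
   (nat \<Rightarrow> real) \<Rightarrow> real \<Rightarrow> real \<Rightarrow> real ^ 'n \<Rightarrow> real" where
  "hardy_weight b k \<alpha> nrm \<mu> s t x =
     (\<Prod>i=1..k. rpow (block_norm b i x) (\<mu> i))
       / (rpow (nrm x) t * rpow (bracket_norm b k \<alpha> x) s)"

definition hardy_psi ::
  "('n::finite \<Rightarrow> nat) \<Rightarrow> nat \<Rightarrow> (nat \<Rightarrow> nat \<Rightarrow> real) \<Rightarrow> (real ^ 'n \<Rightarrow> real) \<Rightarrow> real \<Rightarrow>
   (nat \<Rightarrow> real) \<Rightarrow> real \<Rightarrow> real \<Rightarrow> real ^ 'n \<Rightarrow> real" where
  "hardy_psi b k \<alpha> nrm p \<mu> s t x =
     (\<Prod>i=1..k. rpow (block_norm b i x) (\<mu> i - p * (\<Sum>j=1..k. \<alpha> j i)))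
       / (rpow (nrm x) t * rpow (bracket_norm b k \<alpha> x) (s - p * lam_deg k \<alpha>))"

definition hardy_admissible ::
  "('n::finite \<Rightarrow> nat) \<Rightarrow> nat \<Rightarrow> (nat \<Rightarrow> nat \<Rightarrow> real) \<Rightarrow> real \<Rightarrow> (nat \<Rightarrow> real) \<Rightarrow> real \<Rightarrow> real \<Rightarrow> bool" where
  "hardy_admissible b k \<alpha> p \<mu> s t \<longleftrightarrow>
     s + t < real (block_dim b 1) + \<mu> 1 \<and>
     (\<forall>i\<in>{1..k}. - p * Min (insert 1 ((\<lambda>j. \<alpha> j i) ` {1..k})) + s + t / sig \<alpha> i
                    < real (block_dim b i) + \<mu> i)"

text \<open>
  The numerator of the Hardy constant. For a real exponent \<open>p\<close> the constant is defined only if it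
  is nonnegative. This does not follow from \<open>hardy_admissible\<close>, and the
  inequality can fail for a negative numerator when \<open>p\<close> is an even integer: take \<open>p = 2\<close>, four
  one-dimensional blocks, \<open>\<alpha> 2 1 = \<alpha> 3 2 = 1\<close>, \<open>\<alpha> 4 2 = 2\<close> and the other \<open>\<alpha> i j = 0\<close>, \<open>s = -36\<close>, \<open>t = 38\<close>,
  \<open>\<mu> = (1.1, -1.45, -0.99, -0.99)\<close>. Then \<open>\<psi>\<close> is locally integrable and the numerator is \<open>-0.72\<close>, but the
  integral on the left is infinite and the one on the right finite for \<open>u \<in> C\<^sub>0\<^sup>1(\<real>\<^sup>4)\<close> with \<open>u = 1\<close> near \<open>0\<close>.
\<close>

definition hardy_num ::
  "('n::finite \<Rightarrow> nat) \<Rightarrow> nat \<Rightarrow> (nat \<Rightarrow> nat \<Rightarrow> real) \<Rightarrow> (nat \<Rightarrow> real) \<Rightarrow> real \<Rightarrow> real \<Rightarrow> real" where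
  "hardy_num b k \<alpha> \<mu> s t = hom_dim b k \<alpha> - s - t + (\<Sum>i=1..k. sig \<alpha> i * \<mu> i)"

end

theory Submission
  imports Defs
begin

text \<open>
  No integration by parts is used. Let \<open>\<delta>\<^sub>\<tau> x = (exp (\<sigma>\<^sub>i \<tau>) x\<^sup>(\<^sup>i\<^sup>))\<^sub>i\<close> and let \<open>E = \<Sum> \<sigma>\<^sub>i x\<^sup>(\<^sup>i\<^sup>) \<cdot> \<nabla>\<^sub>i\<close> generate
  these dilations. Then \<open>\<phi> x = - \<integral> (E \<phi>) (\<delta>\<^sub>\<tau> x) d\<tau>\<close> over \<open>\<tau> \<ge> 0\<close>. With \<open>w\<close> the weight on the left and \<open>H\<close>
  the numerator of the Hardy constant, homogeneity of \<open>w\<close> gives \<open>\<integral> w |g \<circ> \<delta>\<^sub>\<tau>|\<^sup>p = exp (- H \<tau>) \<integral> w |g|\<^sup>p\<close>,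
  so Jensen's inequality for the density \<open>c exp (- c \<tau>)\<close> with \<open>c = H / p\<close> and Tonelli's theorem give
  \<open>(H / p)\<^sup>p \<integral> w |\<phi>|\<^sup>p \<le> \<integral> w |E \<phi>|\<^sup>p\<close>. The Cauchy-Schwarz inequality gives
  \<open>|E \<phi>| \<le> [[x]]\<^sup>D (\<Prod> \<lambda>\<^sub>i)\<^sup>-\<^sup>1 |\<nabla>\<^sub>\<lambda> \<phi>|\<close> with \<open>D = 1 + \<Sum> (\<sigma>\<^sub>i - 1)\<close>, and the \<open>p\<close>-th power of this factor times \<open>w\<close> is \<open>\<psi>\<close>.
\<close>

section \<open>Jensen's inequality along a half-line\<close>

text \<open>Young's inequality for the exponents p and p / (p - 1), with compensating powers of
  \<open>h\<close> put on the two factors. With \<open>h\<close> a density and \<open>a\<close> a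
  derivative it is the linearised form of Jensen's inequality; equality holds for a = m h.\<close>

lemma young_weighted:
  fixes p a m h :: real
  assumes "p > 1" "a \<ge> 0" "m \<ge> 0" "h > 0"
  shows "p * m powr (p - 1) * a \<le> h powr (1 - p) * a powr p + (p - 1) * m powr p * h"
proof -
  define q where "q = p / (p - 1)"
  have q: "q > 1" "1 / p + 1 / q = 1"
    using assms(1) by (auto simp: q_def field_simps)
  define A where "A = h powr ((1 - p) / p) * a"
  define B where "B = h powr ((p - 1) / p) * m powr (p - 1)"
  have "h powr ((1 - p) / p) * h powr ((p - 1) / p) = 1"
    using assms by (simp flip: powr_add add_divide_distrib)
  then have "A * B = m powr (p - 1) * a"
    unfolding A_def B_def by (simp add: mult_ac)
  moreover have "A powr p = h powr (1 - p) * a powr p"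
    using assms by (simp add: A_def powr_mult powr_powr)
  moreover have "B powr q = h * m powr p"
    using assms by (simp add: B_def powr_mult powr_powr q_def)
  moreover have "A * B \<le> A powr p / p + B powr q / q"
    using assms q by (intro Youngs_inequality) (auto simp: A_def B_def)
  ultimately have "p * (m powr (p - 1) * a) \<le> p * (h powr (1 - p) * a powr p / p + h * m powr p / q)"
    using assms(1) by (intro mult_left_mono) auto
  moreover have "p * (X / p + Y / q) = X + (p - 1) * Y" for X Y
    using assms(1) by (simp add: q_def field_simps)
  ultimately show ?thesis
    by (simp add: mult_ac)
qed

text \<open>The integrand on the right is the bound that Jensen's inequality gives for the probability
  density \<open>c e\<^sup>-\<^sup>c\<^sup>\<tau>\<close>.\<close>

lemma powr_abs_le_nn_integral_deriv:
  fixes f g :: "real \<Rightarrow> real" and p c T :: real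
  assumes p: "p > 1" and c: "c > 0"
    and f: "\<And>\<tau>. (f has_real_derivative g \<tau>) (at \<tau>)"
    and g: "continuous_on UNIV g"
    and T: "T \<ge> 0" "f T = 0"
  shows "ennreal (\<bar>f 0\<bar> powr p) \<le>
    (\<integral>\<^sup>+\<tau>. ennreal ((c * exp (- c * \<tau>)) powr (1 - p) * \<bar>g \<tau>\<bar> powr p) * indicator {0..} \<tau> \<partial>lborel)"
proof -
  define m where "m = \<bar>f 0\<bar>"
  define h where "h \<tau> = c * exp (- c * \<tau>)" for \<tau>
  define F where "F \<tau> = h \<tau> powr (1 - p) * \<bar>g \<tau>\<bar> powr p" for \<tau>
  have h: "h \<tau> > 0" for \<tau> using c by (simp add: h_def)
  have cont_g: "continuous_on {0..T} g" using g continuous_on_subset by blast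
  have cont_h: "continuous_on {0..T} h" unfolding h_def by (intro continuous_intros)
  have cont_F: "continuous_on {0..T} F"
    unfolding F_def using h p
    by (intro continuous_on_mult continuous_on_powr' continuous_intros cont_g cont_h)
      (auto intro: less_imp_le simp: less_imp_neq[OF h, symmetric])
  \<comment> \<open>The zero of \<open>f\<close> at \<open>T\<close> keeps all integrals on a
    compact interval with continuous integrands; only the last estimate enlarges it to the
    half-line.\<close>
  have "(g has_integral (f T - f 0)) {0..T}"
    using T f by (intro fundamental_theorem_of_calculus)
      (auto simp: has_real_derivative_iff_has_vector_derivative intro: has_vector_derivative_at_within)
  then have g_int: "integral {0..T} g = - f 0" using T by (auto dest: integral_unique)
  have "norm (integral {0..T} g) \<le> integral {0..T} (\<lambda>\<tau>. \<bar>g \<tau>\<bar>)"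
    by (intro integral_norm_bound_integral integrable_continuous_real continuous_intros cont_g) auto
  then have m_le: "m \<le> integral {0..T} (\<lambda>\<tau>. \<bar>g \<tau>\<bar>)" by (simp add: g_int m_def)
  have "(h has_integral (- exp (- c * T) - (- exp (- c * 0)))) {0..T}"
    unfolding h_def using T
    by (intro fundamental_theorem_of_calculus)
      (auto intro!: derivative_eq_intros simp flip: has_real_derivative_iff_has_vector_derivative)
  then have h_int: "integral {0..T} h \<le> 1" by (auto dest!: integral_unique)
  \<comment> \<open>Integrating \<open>young_weighted\<close> puts (p - 1) m^p times the mass of
    \<open>h\<close> on the right. That mass is at most 1 and m^p is finite, so the term can be
    absorbed on the left, where one copy of m^p remains.\<close>
  have "p * m powr p = p * m powr (p - 1) * m"
    by (cases "m = 0") (auto simp: m_def powr_diff)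
  also have "\<dots> \<le> p * m powr (p - 1) * integral {0..T} (\<lambda>\<tau>. \<bar>g \<tau>\<bar>)"
    using m_le p by (intro mult_left_mono) auto
  also have "\<dots> = integral {0..T} (\<lambda>\<tau>. p * m powr (p - 1) * \<bar>g \<tau>\<bar>)" by simp
  also have "\<dots> \<le> integral {0..T} (\<lambda>\<tau>. F \<tau> + (p - 1) * m powr p * h \<tau>)"
    unfolding F_def
    by (intro integral_le integrable_continuous_real continuous_intros young_weighted
        cont_g cont_h cont_F[unfolded F_def]) (use p h in \<open>auto simp: m_def\<close>)
  also have "\<dots> = integral {0..T} F + (p - 1) * m powr p * integral {0..T} h"
    by (subst integral_add)
      (auto intro!: integrable_continuous_real continuous_intros cont_h cont_F)
  also have "\<dots> \<le> integral {0..T} F + (p - 1) * m powr p * 1"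
    using h_int p by (intro add_left_mono mult_left_mono) auto
  finally have *: "m powr p \<le> integral {0..T} F" by (simp add: algebra_simps)
  have "(\<integral>\<^sup>+\<tau>. ennreal (F \<tau>) * indicator {0..T} \<tau> \<partial>lborel) = ennreal (integral {0..T} F)"
    by (intro nn_integral_has_integral_lebesgue' integrable_integral integrable_continuous_real cont_F)
      (auto simp: F_def)
  then have "ennreal (m powr p) \<le> (\<integral>\<^sup>+\<tau>. ennreal (F \<tau>) * indicator {0..T} \<tau> \<partial>lborel)"
    using * by (simp add: ennreal_leI)
  also have "\<dots> \<le> (\<integral>\<^sup>+\<tau>. ennreal (F \<tau>) * indicator {0..} \<tau> \<partial>lborel)"
    by (intro nn_integral_mono mult_left_mono) (auto simp: indicator_def)
  finally show ?thesis by (simp add: F_def h_def m_def)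
qed

section \<open>Dilations and the Hardy inequality for their generator\<close>

text \<open>The parameter is logarithmic, so the dilations form an additive one-parameter group with
  the identity at 0, and homogeneity of degree d reads as a factor exp (d \<tau>). The exponents are
  indexed by coordinates; \<open>dil_exp\<close> later makes them constant on blocks.\<close>

definition dil :: "('n::finite \<Rightarrow> real) \<Rightarrow> real \<Rightarrow> real ^ 'n \<Rightarrow> real ^ 'n" where
  "dil s \<tau> x = (\<chi> m. exp (s m * \<tau>) * x $ m)"

definition euler :: "('n::finite \<Rightarrow> real) \<Rightarrow> (real ^ 'n \<Rightarrow> real) \<Rightarrow> real ^ 'n \<Rightarrow> real" where
  "euler s \<phi> x = (\<Sum>m\<in>UNIV. s m * x $ m * gradient \<phi> x $ m)"

lemma continuous_on_dil [continuous_intros]: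
  "continuous_on A f \<Longrightarrow> continuous_on A g \<Longrightarrow> continuous_on A (\<lambda>y. dil s (f y) (g y))"
  unfolding dil_def by (intro continuous_intros)

text \<open>A diagonal change of variables whose Jacobian determinant is the exponential of \<tau>
  times the sum of the exponents. Stated for \<open>ennreal\<close> functions, so it also covers
  integrals that may be infinite.\<close>

lemma nn_integral_dil:
  fixes f :: "real ^ 'n::finite \<Rightarrow> ennreal"
  assumes [measurable]: "f \<in> borel_measurable borel"
  shows "(\<integral>\<^sup>+x. f (dil s \<tau> x) \<partial>lborel) = ennreal (exp (- \<tau> * (\<Sum>m\<in>UNIV. s m))) * (\<integral>\<^sup>+x. f x \<partial>lborel)"
proof -
  define e :: "real ^ 'n" where "e = (\<chi> m. exp (s m * \<tau>))"
  have Basis: "Basis = range (\<lambda>m::'n. axis m (1::real))"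
    by (auto simp: Basis_vec_def)
  have inj: "inj (\<lambda>m::'n. axis m (1::real))"
    by (auto intro!: injI simp: axis_eq_axis)
  have pos: "e \<bullet> j > 0" if "j \<in> Basis" for j
    using that by (auto simp: Basis inner_axis e_def)
  \<comment> \<open>The shape that \<open>lborel_affine_euclidean\<close> works with: zero shift,
    and the stretching factors as inner products \<open>e \<bullet> j\<close>.\<close>
  have T: "dil s \<tau> = (\<lambda>x. 0 + (\<Sum>j\<in>Basis. (e \<bullet> j * (x \<bullet> j)) *\<^sub>R j))"
    unfolding Basis sum.reindex[OF inj]
    by (intro ext, simp add: inner_axis e_def dil_def vec_eq_iff)
      (simp add: axis_def if_distrib[of "\<lambda>r. _ * r"] cong: if_cong)
  have P: "(\<Prod>j\<in>Basis. \<bar>e \<bullet> j\<bar>) = exp (\<tau> * (\<Sum>m\<in>UNIV. s m))"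
    by (simp add: Basis prod.reindex[OF inj] inner_axis e_def exp_sum sum_distrib_left mult.commute)
  have "lborel = density (distr lborel borel (\<lambda>x. 0 + (\<Sum>j\<in>Basis. (e \<bullet> j * (x \<bullet> j)) *\<^sub>R j)))
      (\<lambda>_. ennreal (\<Prod>j\<in>Basis. \<bar>e \<bullet> j\<bar>))"
    by (rule lborel_affine_euclidean) (use pos in force)
  then have L: "lborel = density (distr lborel borel (dil s \<tau>)) (\<lambda>_. ennreal (exp (\<tau> * (\<Sum>m\<in>UNIV. s m))))"
    unfolding T[symmetric] P .
  have [measurable]: "dil s \<tau> \<in> borel_measurable borel"
    by (intro borel_measurable_continuous_onI continuous_intros)
  have "(\<integral>\<^sup>+x. f x \<partial>lborel) =
      (\<integral>\<^sup>+x. f x \<partial>density (distr lborel borel (dil s \<tau>)) (\<lambda>_. ennreal (exp (\<tau> * (\<Sum>m\<in>UNIV. s m)))))"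
    by (rule arg_cong[OF L])
  also have "\<dots> = ennreal (exp (\<tau> * (\<Sum>m\<in>UNIV. s m))) * (\<integral>\<^sup>+x. f (dil s \<tau> x) \<partial>lborel)"
    by (simp add: nn_integral_density nn_integral_distr nn_integral_cmult)
  finally show ?thesis
    by (simp add: mult.assoc[symmetric] ennreal_mult[symmetric] exp_minus)
qed

text \<open>The chain rule: differentiating exp (s m \<tau>) reproduces the dilated coordinate, so
  the generator is evaluated at the moving point of the orbit.\<close>

lemma has_real_derivative_along_dil:
  assumes "\<phi> differentiable_on UNIV"
  shows "((\<lambda>\<tau>. \<phi> (dil s \<tau> x)) has_real_derivative euler s \<phi> (dil s \<tau> x)) (at \<tau>)"
proof -
  let ?D = "frechet_derivative \<phi> (at (dil s \<tau> x))"
  have D: "(\<phi> has_derivative ?D) (at (dil s \<tau> x))"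
    using assms by (auto simp: differentiable_on_def frechet_derivative_works)
  interpret linear ?D using D by (rule has_derivative_linear)
  have dil_eq: "dil s t x = (\<Sum>m\<in>UNIV. (exp (s m * t) * x $ m) *\<^sub>R axis m 1)" for t
    by (simp add: dil_def vec_eq_iff axis_def if_distrib[of "\<lambda>r. _ * r"] cong: if_cong)
  have "((\<lambda>t. dil s t x) has_derivative
      (\<lambda>h. \<Sum>m\<in>UNIV. (h * (s m * dil s \<tau> x $ m)) *\<^sub>R axis m 1)) (at \<tau>)"
    unfolding dil_eq
    by (auto intro!: derivative_eq_intros sum.cong simp: axis_def vec_eq_iff algebra_simps
         if_distrib[of "\<lambda>r. _ * r"] cong: if_cong)
  from has_derivative_compose[OF this D]
  have "((\<lambda>t. \<phi> (dil s t x)) has_derivative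
      (\<lambda>h. \<Sum>m\<in>UNIV. (h * (s m * dil s \<tau> x $ m)) *\<^sub>R ?D (axis m 1))) (at \<tau>)"
    by (simp add: sum scale)
  then show ?thesis
    unfolding has_field_derivative_def euler_def gradient_def
    by (rule has_derivative_eq_rhs) (auto simp: sum_distrib_left mult_ac)
qed

lemma borel_measurable_euler [measurable]:
  assumes "continuous_on UNIV (gradient \<phi>)"
  shows "euler s \<phi> \<in> borel_measurable borel"
  unfolding euler_def using assms
  by (intro borel_measurable_continuous_onI continuous_intros)

text \<open>No integrability of \<open>w\<close> near the origin is needed: only the vanishing of \<open>\<phi>\<close> at infinity
  along the orbits of the dilations is used.\<close>

lemma hardy_euler:
  fixes w :: "real ^ 'n::finite \<Rightarrow> real" and s :: "'n \<Rightarrow> real" and d p H :: real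
  assumes p: "p > 1"
    and s: "\<And>m. s m > 0"
    and w_meas [measurable]: "w \<in> borel_measurable borel"
    and w_nonneg: "\<And>x. w x \<ge> 0"
    and w_dil: "\<And>\<tau> x. w (dil s \<tau> x) = exp (d * \<tau>) * w x"
    and H: "H = (\<Sum>m\<in>UNIV. s m) + d" "H > 0"
    and diff: "\<phi> differentiable_on UNIV"
    and cont: "continuous_on UNIV (gradient \<phi>)"
    and bdd: "bounded {x. \<phi> x \<noteq> 0}"
  shows "ennreal ((H / p) powr p) * (\<integral>\<^sup>+x. ennreal (w x * \<bar>\<phi> x\<bar> powr p) \<partial>lborel)
    \<le> (\<integral>\<^sup>+x. ennreal (w x * \<bar>euler s \<phi> x\<bar> powr p) \<partial>lborel)"
proof -
  \<comment> \<open>For a density of rate c the \<tau>-integrand below decays like exp (- (H - c (p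
    - 1)) \<tau>), which gives the constant c^(1 - p) / (H - c (p - 1)). This is smallest at c = H /
    p, where it equals c^(- p).\<close>
  define c where "c = H / p"
  have c: "c > 0" using p H by (simp add: c_def)
  define h where "h \<tau> = (c * exp (- c * \<tau>)) powr (1 - p)" for \<tau>
  define E where "E = euler s \<phi>"
  have E_meas [measurable]: "E \<in> borel_measurable borel"
    unfolding E_def using cont by simp
  have cont_E: "continuous_on UNIV E"
    unfolding E_def euler_def using cont by (intro continuous_intros)
  have h_meas [measurable]: "h \<in> borel_measurable borel" unfolding h_def by measurable
  have h_nonneg: "h \<tau> \<ge> 0" for \<tau> by (simp add: h_def)
  define I where "I = (\<integral>\<^sup>+x. ennreal (w x * \<bar>E x\<bar> powr p) \<partial>lborel)"
  have dil_meas [measurable]: "(\<lambda>(\<tau>, x). dil s \<tau> x) \<in> borel_measurable (borel \<Otimes>\<^sub>M borel)"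
    unfolding borel_prod split_beta
    by (intro borel_measurable_continuous_onI continuous_intros)
  define K where "K \<tau> x = ennreal (w x) * (ennreal (h \<tau> * \<bar>E (dil s \<tau> x)\<bar> powr p) * indicator {0..} \<tau>)" for \<tau> x
  have K_meas: "case_prod K \<in> borel_measurable (lborel \<Otimes>\<^sub>M lborel)"
    unfolding K_def by measurable
  \<comment> \<open>The origin is fixed by the dilations, so its orbit never leaves the support.
    Every other orbit does, and a single point is a null set.\<close>
  have le_K: "ennreal (w x * \<bar>\<phi> x\<bar> powr p) \<le> (\<integral>\<^sup>+\<tau>. K \<tau> x \<partial>lborel)" if "x \<noteq> 0" for x
  proof -
    obtain m where m: "x $ m \<noteq> 0" using \<open>x \<noteq> 0\<close> by (auto simp: vec_eq_iff)
    obtain B where B: "\<And>y. \<phi> y \<noteq> 0 \<Longrightarrow> norm y \<le> B" using bdd by (auto simp: bounded_iff)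
    \<comment> \<open>Chosen for the bound 1 + y \<le> exp y: it makes (1 + s m T) \<bar>x $ m\<bar>
      equal to \<bar>x $ m\<bar> + \<bar>B\<bar>, which exceeds \<open>B\<close>. The absolute value
      covers a negative \<open>B\<close>, possible when \<phi> vanishes identically.\<close>
    define T where "T = \<bar>B\<bar> / (s m * \<bar>x $ m\<bar>)"
    have "T \<ge> 0" using s[of m] by (simp add: T_def)
    have "s m * T * \<bar>x $ m\<bar> = \<bar>B\<bar>" using m s[of m] by (simp add: T_def)
    then have "B < (1 + s m * T) * \<bar>x $ m\<bar>" using m by (simp add: distrib_right)
    also have "\<dots> \<le> exp (s m * T) * \<bar>x $ m\<bar>"
      by (intro mult_right_mono exp_ge_add_one_self) auto
    finally have T: "exp (s m * T) * \<bar>x $ m\<bar> > B" .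
    have "norm (dil s T x) > B"
      using T component_le_norm_cart[of "dil s T x" m] by (simp add: dil_def abs_mult)
    then have "\<phi> (dil s T x) = 0" using B by force
    moreover have "dil s 0 x = x" by (simp add: dil_def vec_eq_iff)
    moreover have "continuous_on UNIV (\<lambda>\<tau>. E (dil s \<tau> x))"
      by (intro continuous_on_compose2[OF cont_E] continuous_intros) auto
    ultimately have "ennreal (\<bar>\<phi> x\<bar> powr p)
        \<le> (\<integral>\<^sup>+\<tau>. ennreal (h \<tau> * \<bar>E (dil s \<tau> x)\<bar> powr p) * indicator {0..} \<tau> \<partial>lborel)"
      using powr_abs_le_nn_integral_deriv[OF p c, of "\<lambda>\<tau>. \<phi> (dil s \<tau> x)" "\<lambda>\<tau>. E (dil s \<tau> x)" T]
        has_real_derivative_along_dil[OF diff] \<open>T \<ge> 0\<close> unfolding E_def h_def by simp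
    then have "ennreal (w x) * ennreal (\<bar>\<phi> x\<bar> powr p)
        \<le> ennreal (w x) * (\<integral>\<^sup>+\<tau>. ennreal (h \<tau> * \<bar>E (dil s \<tau> x)\<bar> powr p) * indicator {0..} \<tau> \<partial>lborel)"
      by (intro mult_left_mono) auto
    then show ?thesis
      using w_nonneg unfolding K_def by (simp add: nn_integral_cmult ennreal_mult)
  qed
  have inner: "(\<integral>\<^sup>+x. K \<tau> x \<partial>lborel) = ennreal (c powr (1 - p) * exp (- c * \<tau>)) * indicator {0..} \<tau> * I" for \<tau>
  proof -
    \<comment> \<open>Homogeneity trades \<open>w x\<close> for \<open>w\<close> at the dilated
      point, so that all of the x-dependence goes through \<open>dil s \<tau> x\<close> and the
      change of variables applies.\<close>
    have K_eq: "K \<tau> x = ennreal (h \<tau> * exp (- d * \<tau>)) * indicator {0..} \<tau> *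
        ennreal (w (dil s \<tau> x) * \<bar>E (dil s \<tau> x)\<bar> powr p)" for x
    proof -
      have "w x = exp (- d * \<tau>) * w (dil s \<tau> x)" by (simp add: w_dil exp_minus)
      then have "w x * (h \<tau> * \<bar>E (dil s \<tau> x)\<bar> powr p) =
          h \<tau> * exp (- d * \<tau>) * (w (dil s \<tau> x) * \<bar>E (dil s \<tau> x)\<bar> powr p)"
        by simp
      then have "ennreal (w x * (h \<tau> * \<bar>E (dil s \<tau> x)\<bar> powr p)) =
          ennreal (h \<tau> * exp (- d * \<tau>) * (w (dil s \<tau> x) * \<bar>E (dil s \<tau> x)\<bar> powr p))"
        by (rule arg_cong)
      then have eq: "ennreal (w x) * ennreal (h \<tau> * \<bar>E (dil s \<tau> x)\<bar> powr p) =
          ennreal (h \<tau> * exp (- d * \<tau>)) * ennreal (w (dil s \<tau> x) * \<bar>E (dil s \<tau> x)\<bar> powr p)"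
        by (subst (asm) (1 2) ennreal_mult) (simp_all only: h_nonneg w_nonneg mult_nonneg_nonneg exp_ge_zero powr_ge_zero)
      have swap: "a * b * c = a * c * b" for a b c :: ennreal by (simp only: mult.assoc mult.commute[of b])
      show ?thesis
        unfolding K_def mult.assoc[symmetric, of "ennreal (w x)"] eq by (rule swap)
    qed
    have dil_meas1: "dil s \<tau> \<in> borel_measurable borel"
      by (intro borel_measurable_continuous_onI continuous_intros)
    have meas1: "(\<lambda>x. ennreal (w (dil s \<tau> x) * \<bar>E (dil s \<tau> x)\<bar> powr p)) \<in> borel_measurable lborel"
      using dil_meas1 by measurable
    have "(\<integral>\<^sup>+x. K \<tau> x \<partial>lborel) = ennreal (h \<tau> * exp (- d * \<tau>)) * indicator {0..} \<tau> *
        (\<integral>\<^sup>+x. ennreal (w (dil s \<tau> x) * \<bar>E (dil s \<tau> x)\<bar> powr p) \<partial>lborel)"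
      unfolding K_eq by (rule nn_integral_cmult[OF meas1])
    also have "\<dots> = ennreal (h \<tau> * exp (- d * \<tau>)) * indicator {0..} \<tau> *
        (ennreal (exp (- \<tau> * (\<Sum>m\<in>UNIV. s m))) * I)"
      unfolding I_def
      by (subst nn_integral_dil[of "\<lambda>x. ennreal (w x * \<bar>E x\<bar> powr p)"]) auto
    also have "\<dots> = ennreal (h \<tau> * exp (- d * \<tau>) * exp (- \<tau> * (\<Sum>m\<in>UNIV. s m))) * indicator {0..} \<tau> * I"
      using h_nonneg by (simp add: ennreal_mult mult_ac)
    also have "h \<tau> * exp (- d * \<tau>) * exp (- \<tau> * (\<Sum>m\<in>UNIV. s m)) = c powr (1 - p) * exp (- c * \<tau>)"
    proof -
      have "h \<tau> = c powr (1 - p) * exp (- c * \<tau> * (1 - p))"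
        using c by (simp add: h_def powr_mult exp_powr_real)
      then have "h \<tau> * exp (- d * \<tau>) * exp (- \<tau> * (\<Sum>m\<in>UNIV. s m)) =
          c powr (1 - p) * exp (- c * \<tau> * (1 - p) + - d * \<tau> + - \<tau> * (\<Sum>m\<in>UNIV. s m))"
        by (simp only: exp_add mult.assoc)
      also have "- c * \<tau> * (1 - p) + - d * \<tau> + - \<tau> * (\<Sum>m\<in>UNIV. s m) = - c * \<tau> + \<tau> * (c * p - H)"
        by (simp add: H algebra_simps)
      also have "\<dots> = - c * \<tau>" using p by (simp add: c_def)
      finally show ?thesis .
    qed
    finally show ?thesis .
  qed
  have "((\<lambda>\<tau>. c powr (1 - p) * exp (- c * \<tau>)) has_integral c powr (1 - p) * (exp (- c * 0) / c)) {0..}"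
    using c by (intro has_integral_mult_right has_integral_exp_minus_to_infinity)
  then have "(\<integral>\<^sup>+\<tau>. ennreal (c powr (1 - p) * exp (- c * \<tau>)) * indicator {0..} \<tau> \<partial>lborel)
      = ennreal (c powr (1 - p) * (exp (- c * 0) / c))"
    by (intro nn_integral_has_integral_lebesgue') auto
  also have "c powr (1 - p) * (exp (- c * 0) / c) = c powr - p"
    using c by (simp add: powr_diff powr_minus field_simps)
  finally have exp_int: "(\<integral>\<^sup>+\<tau>. ennreal (c powr (1 - p) * exp (- c * \<tau>)) * indicator {0..} \<tau> \<partial>lborel)
      = ennreal (c powr - p)" .
  have "AE x in lborel. x \<noteq> (0 :: real ^ 'n)" by (rule AE_lborel_singleton)
  then have "(\<integral>\<^sup>+x. ennreal (w x * \<bar>\<phi> x\<bar> powr p) \<partial>lborel) \<le> (\<integral>\<^sup>+x. (\<integral>\<^sup>+\<tau>. K \<tau> x \<partial>lborel) \<partial>lborel)"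
    by (intro nn_integral_mono_AE) (auto intro: le_K elim!: eventually_mono)
  also have "\<dots> = (\<integral>\<^sup>+\<tau>. (\<integral>\<^sup>+x. K \<tau> x \<partial>lborel) \<partial>lborel)"
    by (rule pair_sigma_finite.Fubini'[OF _ K_meas]) (simp add: pair_sigma_finite_def lborel.sigma_finite_measure_axioms)
  also have "\<dots> = ennreal (c powr - p) * I"
    unfolding inner exp_int[symmetric] by (rule nn_integral_multc) measurable
  finally have "ennreal (c powr p) * (\<integral>\<^sup>+x. ennreal (w x * \<bar>\<phi> x\<bar> powr p) \<partial>lborel)
      \<le> ennreal (c powr p) * (ennreal (c powr - p) * I)"
    by (intro mult_left_mono) auto
  also have "\<dots> = I"
    using c by (simp add: mult.assoc[symmetric] ennreal_mult[symmetric] powr_minus)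
  finally show ?thesis by (simp add: I_def E_def c_def)
qed

section \<open>Passage to limits of test functions\<close>

text \<open>Convexity of the p-th power at the points norm a / (1 - \<theta>) and norm c / \<theta>;
  the case split keeps both positive. The coefficient of norm a ^ p tends to 1 as \<theta> tends to
  0, so this replaces Minkowski's inequality without taking roots of possibly infinite
  integrals.\<close>

lemma powr_norm_add_le:
  fixes a c :: "'a::real_normed_vector" and p \<theta> :: real
  assumes "p \<ge> 1" "0 < \<theta>" "\<theta> < 1"
  shows "norm (a + c) powr p \<le> (1 - \<theta>) powr (1 - p) * norm a powr p + \<theta> powr (1 - p) * norm c powr p"
proof (cases "a = 0 \<or> c = 0")
  case True
  have "r powr (1 - p) \<ge> 1" if "0 < r" "r < 1" for r
    using powr_mono'[of "1 - p" 0 r] that assms(1) by simp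
  then have "1 * norm a powr p \<le> (1 - \<theta>) powr (1 - p) * norm a powr p"
    "1 * norm c powr p \<le> \<theta> powr (1 - p) * norm c powr p"
    using assms by (intro mult_right_mono; simp)+
  with True show ?thesis using assms by auto
next
  case False
  let ?a = "norm a / (1 - \<theta>)" and ?c = "norm c / \<theta>"
  have "norm (a + c) powr p \<le> (norm a + norm c) powr p"
    using assms by (intro powr_mono2 norm_triangle_ineq) auto
  also have "norm a + norm c = (1 - \<theta>) *\<^sub>R ?a + \<theta> *\<^sub>R ?c"
    using assms by simp
  also have "\<dots> powr p \<le> (1 - \<theta>) * ?a powr p + \<theta> * ?c powr p"
    using assms False by (intro convex_onD[OF powr_convex, of p]) auto
  also have "\<dots> = (1 - \<theta>) powr (1 - p) * norm a powr p + \<theta> powr (1 - p) * norm c powr p"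
    using assms by (simp add: powr_divide powr_diff)
  finally show ?thesis .
qed

text \<open>The left side passes to the limit by Fatou's lemma, the right side by writing
  \<open>F n\<close> as \<open>G\<close> plus an error and applying
  \<open>powr_norm_add_le\<close>.\<close>

lemma Lp_inequality_closure:
  fixes w \<psi> u :: "'a \<Rightarrow> real" and \<phi> :: "nat \<Rightarrow> 'a \<Rightarrow> real"
    and F :: "nat \<Rightarrow> 'a \<Rightarrow> 'b::euclidean_space" and G :: "'a \<Rightarrow> 'b"
  assumes p: "p > 1"
    and [measurable]: "w \<in> borel_measurable M" "\<psi> \<in> borel_measurable M" "G \<in> borel_measurable M"
      "\<And>n. \<phi> n \<in> borel_measurable M" "\<And>n. F n \<in> borel_measurable M"
    and nonneg: "\<And>x. w x \<ge> 0" "\<And>x. \<psi> x \<ge> 0"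
    and le: "\<And>n. (\<integral>\<^sup>+x. ennreal (w x * \<bar>\<phi> n x\<bar> powr p) \<partial>M)
      \<le> (\<integral>\<^sup>+x. ennreal (\<psi> x * norm (F n x) powr p) \<partial>M)"
    and u: "AE x in M. (\<lambda>n. \<phi> n x) \<longlonglongrightarrow> u x"
    and lim: "(\<lambda>n. \<integral>\<^sup>+x. ennreal (\<psi> x * norm (F n x - G x) powr p) \<partial>M) \<longlonglongrightarrow> 0"
  shows "(\<integral>\<^sup>+x. ennreal (w x * \<bar>u x\<bar> powr p) \<partial>M) \<le> (\<integral>\<^sup>+x. ennreal (\<psi> x * norm (G x) powr p) \<partial>M)"
proof -
  define J where "J = (\<integral>\<^sup>+x. ennreal (\<psi> x * norm (G x) powr p) \<partial>M)"
  define I where "I n = (\<integral>\<^sup>+x. ennreal (w x * \<bar>\<phi> n x\<bar> powr p) \<partial>M)" for n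
  define D where "D n = (\<integral>\<^sup>+x. ennreal (\<psi> x * norm (F n x - G x) powr p) \<partial>M)" for n
  have "AE x in M. ennreal (w x * \<bar>u x\<bar> powr p) = liminf (\<lambda>n. ennreal (w x * \<bar>\<phi> n x\<bar> powr p))"
    using u
  proof eventually_elim
    case (elim x)
    have "(\<lambda>n. ennreal (w x * \<bar>\<phi> n x\<bar> powr p)) \<longlonglongrightarrow> ennreal (w x * \<bar>u x\<bar> powr p)"
      using p by (intro tendsto_ennrealI tendsto_mult tendsto_const tendsto_powr' tendsto_rabs elim) auto
    then show ?case by (simp add: lim_imp_Liminf)
  qed
  then have "(\<integral>\<^sup>+x. ennreal (w x * \<bar>u x\<bar> powr p) \<partial>M)
      = (\<integral>\<^sup>+x. liminf (\<lambda>n. ennreal (w x * \<bar>\<phi> n x\<bar> powr p)) \<partial>M)"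
    by (rule nn_integral_cong_AE)
  also have "\<dots> \<le> liminf I"
    unfolding I_def by (rule nn_integral_liminf) measurable
  finally have u_le: "(\<integral>\<^sup>+x. ennreal (w x * \<bar>u x\<bar> powr p) \<partial>M) \<le> liminf I" .
  \<comment> \<open>The order of the limits matters: the coefficient \<theta>^(1 - p) of the error
    blows up as \<theta> tends to 0, so n goes to infinity first, at fixed \<theta>.\<close>
  have theta: "(\<integral>\<^sup>+x. ennreal (w x * \<bar>u x\<bar> powr p) \<partial>M) \<le> ennreal ((1 - \<theta>) powr (1 - p)) * J"
    if \<theta>: "0 < \<theta>" "\<theta> < 1" for \<theta>
  proof -
    have "I n \<le> ennreal ((1 - \<theta>) powr (1 - p)) * J + ennreal (\<theta> powr (1 - p)) * D n" for n
    proof -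
      have "ennreal (\<psi> x * norm (F n x) powr p) \<le> ennreal ((1 - \<theta>) powr (1 - p)) * ennreal (\<psi> x * norm (G x) powr p)
          + ennreal (\<theta> powr (1 - p)) * ennreal (\<psi> x * norm (F n x - G x) powr p)" for x
      proof -
        have "\<psi> x * norm (G x + (F n x - G x)) powr p \<le> \<psi> x * ((1 - \<theta>) powr (1 - p) * norm (G x) powr p +
            \<theta> powr (1 - p) * norm (F n x - G x) powr p)"
          using p \<theta> nonneg(2) by (intro mult_left_mono powr_norm_add_le) auto
        then have "ennreal (\<psi> x * norm (F n x) powr p) \<le> ennreal ((1 - \<theta>) powr (1 - p) * (\<psi> x * norm (G x) powr p)
          + \<theta> powr (1 - p) * (\<psi> x * norm (F n x - G x) powr p))"
          by (intro ennreal_leI) (simp add: algebra_simps)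
        then show ?thesis using nonneg(2)[of x] by (simp add: ennreal_mult)
      qed
      then have "(\<integral>\<^sup>+x. ennreal (\<psi> x * norm (F n x) powr p) \<partial>M)
          \<le> (\<integral>\<^sup>+x. ennreal ((1 - \<theta>) powr (1 - p)) * ennreal (\<psi> x * norm (G x) powr p)
          + ennreal (\<theta> powr (1 - p)) * ennreal (\<psi> x * norm (F n x - G x) powr p) \<partial>M)"
        by (intro nn_integral_mono)
      also have "\<dots> = ennreal ((1 - \<theta>) powr (1 - p)) * J + ennreal (\<theta> powr (1 - p)) * D n"
        unfolding J_def D_def by (subst nn_integral_add) (simp_all add: nn_integral_cmult)
      finally show ?thesis using le[of n] unfolding I_def by (rule order_trans[rotated])
    qed
    moreover have "(\<lambda>n. ennreal ((1 - \<theta>) powr (1 - p)) * J + ennreal (\<theta> powr (1 - p)) * D n)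
        \<longlonglongrightarrow> ennreal ((1 - \<theta>) powr (1 - p)) * J + ennreal (\<theta> powr (1 - p)) * 0"
      using lim unfolding D_def by (intro tendsto_intros tendsto_mult_ennreal) auto
    ultimately have "liminf I \<le> ennreal ((1 - \<theta>) powr (1 - p)) * J"
      by (metis (no_types, lifting) Liminf_mono add.right_neutral always_eventually lim_imp_Liminf mult_zero_right
          sequentially_bot)
    then show ?thesis using u_le by (meson order_trans)
  qed
  have "((\<lambda>\<theta>. ennreal ((1 - \<theta>) powr (1 - p)) * J) \<longlongrightarrow> ennreal ((1 - 0) powr (1 - p)) * J) (at_right (0::real))"
    by (intro tendsto_mult_ennreal tendsto_ennrealI tendsto_powr tendsto_diff tendsto_const tendsto_ident_at) auto
  moreover have "\<forall>\<^sub>F \<theta> in at_right 0. (\<integral>\<^sup>+x. ennreal (w x * \<bar>u x\<bar> powr p) \<partial>M)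
      \<le> ennreal ((1 - \<theta>) powr (1 - p)) * J"
    using theta by (auto simp: eventually_at_right_field intro!: exI[of _ 1])
  ultimately show ?thesis
    unfolding J_def[symmetric] by (intro tendsto_lowerbound) (auto simp: trivial_limit_at_right_real)
qed

lemma nn_integral_lebesgue_on:
  fixes f :: "'a::euclidean_space \<Rightarrow> ennreal"
  assumes "open \<Omega>"
  shows "(\<integral>\<^sup>+x. f x \<partial>lebesgue_on \<Omega>) = (\<integral>\<^sup>+x. f x * indicator \<Omega> x \<partial>lborel)"
proof -
  have "\<Omega> \<in> sets lebesgue" using assms by (intro sets_completionI_sets) simp
  then show ?thesis by (simp add: nn_integral_restrict_space nn_integral_completion)
qed

section \<open>Block norms and the null set of vanishing blocks\<close>

abbreviation dil_exp :: "('n::finite \<Rightarrow> nat) \<Rightarrow> (nat \<Rightarrow> nat \<Rightarrow> real) \<Rightarrow> 'n \<Rightarrow> real" where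
  "dil_exp b \<alpha> \<equiv> \<lambda>m. sig \<alpha> (b m)"

lemma rpow_nonneg [simp]: "rpow y a \<ge> 0"
  by (simp add: rpow_def)

lemma rpow_eq_powr: "y > 0 \<Longrightarrow> rpow y a = y powr a"
  by (simp add: rpow_def)

lemma rpow_exp_mult: "y \<ge> 0 \<Longrightarrow> rpow (exp r * y) a = exp (a * r) * rpow y a"
  by (simp add: rpow_def powr_mult exp_powr_real mult.commute)

lemma borel_measurable_rpow [measurable (raw)]:
  "f \<in> borel_measurable M \<Longrightarrow> (\<lambda>x. rpow (f x) a) \<in> borel_measurable M"
  by (cases "a = 0") (simp_all add: rpow_def)

lemma block_norm_nonneg [simp]: "block_norm b i x \<ge> 0"
  by (simp add: block_norm_def)

lemma borel_measurable_block_norm [measurable]: "block_norm b i \<in> borel_measurable borel"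
  unfolding block_norm_def L2_set_def
  by (intro borel_measurable_continuous_onI continuous_intros)

lemma borel_measurable_lam [measurable]: "lam b k \<alpha> i \<in> borel_measurable borel"
  unfolding lam_def by measurable

lemma borel_measurable_bracket_norm [measurable]: "bracket_norm b k \<alpha> \<in> borel_measurable borel"
  unfolding bracket_norm_def by measurable

lemma block_norm_dil: "block_norm b i (dil (dil_exp b \<alpha>) \<tau> x) = exp (sig \<alpha> i * \<tau>) * block_norm b i x"
  unfolding block_norm_def by (subst L2_set_right_distrib) (auto simp: dil_def intro: L2_set_cong)

lemma block_norm_pos:
  assumes "x $ m \<noteq> 0"
  shows "block_norm b (b m) x > 0"
  using assms block_norm_nonneg[of b "b m" x]
  unfolding block_norm_def by (auto simp: L2_set_eq_0_iff less_le)

text \<open>Every block contains a coordinate, so a vanishing block puts the point on one of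
  finitely many coordinate hyperplanes. Off this null set all bases are positive and the laws of
  real powers apply.\<close>

lemma negligible_block_norm_0:
  fixes b :: "'n::finite \<Rightarrow> nat"
  assumes "range b = {1..k}"
  shows "negligible {x. \<exists>i\<in>{1..k}. block_norm b i x = 0}"
proof (rule negligible_subset)
  show "negligible (\<Union>m. {x :: real ^ 'n. x $ m = 0})"
    by (intro negligible_Union) (auto simp: negligible_standard_hyperplane_cart)
  have "\<exists>m. x $ m = 0" if "i \<in> {1..k}" "block_norm b i x = 0" for i x
  proof -
    from that(1) assms obtain m where "b m = i" by (metis imageE)
    then show ?thesis using that(2) block_norm_pos[of x m b] by (metis less_irrefl)
  qed
  then show "{x. \<exists>i\<in>{1..k}. block_norm b i x = 0} \<subseteq> (\<Union>m. {x. x $ m = 0})" by blast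
qed

lemma AE_block_norm_pos:
  assumes "range b = {1..k}"
  shows "AE x in lebesgue. \<forall>i\<in>{1..k}. block_norm b i x > 0"
proof -
  have "\<not> (\<forall>i\<in>{1..k}. block_norm b i x > 0) \<Longrightarrow> \<exists>i\<in>{1..k}. block_norm b i x = 0" for x
    using block_norm_nonneg by (metis less_eq_real_def)
  then show ?thesis
    using negligible_block_norm_0[OF assms] unfolding eventually_ae_filter_negligible by blast
qed

section \<open>Scaling of the lambda system and the Cauchy-Schwarz estimate\<close>

context
  fixes b :: "'n::finite \<Rightarrow> nat" and k :: nat and \<alpha> :: "nat \<Rightarrow> nat \<Rightarrow> real"
  assumes sys: "lam_system b k \<alpha>"
begin

lemma range_b: "range b = {1..k}"
  using sys by (simp add: lam_system_def)

lemma k_ge_1: "k \<ge> 1"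
  using range_b by (metis UNIV_not_empty atLeastatMost_empty_iff image_is_empty)

lemma alpha_nonneg: "i \<in> {1..k} \<Longrightarrow> j \<in> {1..k} \<Longrightarrow> \<alpha> i j \<ge> 0"
  using sys unfolding lam_system_def by (metis linorder_not_le order_refl)

lemma alpha_eq_0: "i \<in> {1..k} \<Longrightarrow> j \<in> {1..k} \<Longrightarrow> i \<le> j \<Longrightarrow> \<alpha> i j = 0"
  using sys unfolding lam_system_def by blast

text \<open>The entries of \<alpha> with j \<ge> i vanish, so the recursion may run over all blocks,
  matching the product in \<open>lam\<close>.\<close>

lemma sig_eq: "i \<in> {1..k} \<Longrightarrow> sig \<alpha> i = 1 + (\<Sum>j=1..k. \<alpha> i j * sig \<alpha> j)"
  by (subst sig.simps, intro arg_cong[of _ _ "\<lambda>r. 1 + r"] sum.mono_neutral_left)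
    (auto simp: alpha_eq_0)

lemma sig_ge_1: "i \<in> {1..k} \<Longrightarrow> sig \<alpha> i \<ge> 1"
proof (induction i rule: less_induct)
  case (less i)
  have "\<alpha> i j * sig \<alpha> j \<ge> 0" if "j \<in> {1..<i}" for j
    using less.IH[of j] less.prems that alpha_nonneg[of i j] by (intro mult_nonneg_nonneg) auto
  then have "(\<Sum>j\<in>{1..<i}. \<alpha> i j * sig \<alpha> j) \<ge> 0"
    by (rule sum_nonneg)
  then show ?case by (subst sig.simps) simp
qed

lemma sig_pos: "i \<in> {1..k} \<Longrightarrow> sig \<alpha> i > 0"
  using sig_ge_1[of i] by simp

lemma dil_exp_pos: "dil_exp b \<alpha> m > 0"
  using range_b by (intro sig_pos) blast

lemma sum_by_blocks:
  fixes f :: "'n \<Rightarrow> 'c::comm_monoid_add"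
  shows "(\<Sum>m\<in>UNIV. f m) = (\<Sum>i=1..k. \<Sum>m\<in>{m. b m = i}. f m)"
  using sum.group[of UNIV "{1..k}" b f] range_b by simp

lemma hom_dim_eq: "hom_dim b k \<alpha> = (\<Sum>m\<in>UNIV. dil_exp b \<alpha> m)"
  unfolding hom_dim_def block_dim_def sum_by_blocks by (simp add: mult.commute)

text \<open>Serves the special case of the theorem, where admissibility bounds p by the dimension of
  the first block. The first summand of \<open>hom_dim\<close> is that dimension, because
  \<open>sig \<alpha> 1\<close> is 1.\<close>

lemma block_dim_1_le_hom_dim: "real (block_dim b 1) \<le> hom_dim b k \<alpha>"
proof -
  have "sig \<alpha> 1 * real (block_dim b 1) \<le> hom_dim b k \<alpha>"
    unfolding hom_dim_def using k_ge_1
    by (intro member_le_sum[of 1 "{1..k}" "\<lambda>i. sig \<alpha> i * real (block_dim b i)"]) (auto intro!: mult_nonneg_nonneg less_imp_le[OF sig_pos])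
  moreover have "sig \<alpha> 1 = 1" by (subst sig.simps) simp
  ultimately show ?thesis by simp
qed

lemma lam_deg_ge_1: "lam_deg k \<alpha> \<ge> 1"
  unfolding lam_deg_def using sig_ge_1 by (auto intro!: sum_nonneg)

text \<open>The factor for block j contributes the exponent
  \<open>\<alpha> i j * sig \<alpha> j\<close>, and the recursion for \<open>sig\<close> says
  precisely that these add up to \<open>sig \<alpha> i - 1\<close>.\<close>

lemma lam_dil:
  assumes "i \<in> {1..k}"
  shows "lam b k \<alpha> i (dil (dil_exp b \<alpha>) \<tau> x) = exp ((sig \<alpha> i - 1) * \<tau>) * lam b k \<alpha> i x"
proof -
  have "(\<Prod>j=1..k. exp (\<alpha> i j * (sig \<alpha> j * \<tau>))) = exp ((sig \<alpha> i - 1) * \<tau>)"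
    by (simp add: exp_sum[symmetric] sig_eq[OF assms] sum_distrib_right mult.assoc)
  then show ?thesis
    by (simp add: lam_def block_norm_dil rpow_exp_mult prod.distrib)
qed

text \<open>The j-th summand has degree 2 (\<sigma>_j + \<Sum> (\<sigma>_i - 1)) with i \<noteq> j.
  This is \<open>2 * lam_deg k \<alpha>\<close> for every j, and the outer root normalises it to
  1.\<close>

lemma bracket_norm_dil:
  "bracket_norm b k \<alpha> (dil (dil_exp b \<alpha>) \<tau> x) = exp \<tau> * bracket_norm b k \<alpha> x"
proof -
  let ?D = "dil (dil_exp b \<alpha>) \<tau> x"
  have *: "(\<Prod>i\<in>{1..k} - {j}. (lam b k \<alpha> i ?D)\<^sup>2) * (sig \<alpha> j)\<^sup>2 * (block_norm b j ?D)\<^sup>2 =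
      exp (2 * lam_deg k \<alpha> * \<tau>) *
      ((\<Prod>i\<in>{1..k} - {j}. (lam b k \<alpha> i x)\<^sup>2) * (sig \<alpha> j)\<^sup>2 * (block_norm b j x)\<^sup>2)"
    if j: "j \<in> {1..k}" for j
  proof -
    have "(\<Prod>i\<in>{1..k} - {j}. (lam b k \<alpha> i ?D)\<^sup>2) =
        (\<Prod>i\<in>{1..k} - {j}. exp (2 * (sig \<alpha> i - 1) * \<tau>) * (lam b k \<alpha> i x)\<^sup>2)"
      by (intro prod.cong refl) (simp add: lam_dil power_mult_distrib exp_double[symmetric] mult.assoc)
    also have "\<dots> = exp (2 * (\<Sum>i\<in>{1..k} - {j}. sig \<alpha> i - 1) * \<tau>) * (\<Prod>i\<in>{1..k} - {j}. (lam b k \<alpha> i x)\<^sup>2)"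
      by (simp add: prod.distrib exp_sum[symmetric] sum_distrib_right sum_distrib_left)
    finally have 1: "(\<Prod>i\<in>{1..k} - {j}. (lam b k \<alpha> i ?D)\<^sup>2) =
        exp (2 * (\<Sum>i\<in>{1..k} - {j}. sig \<alpha> i - 1) * \<tau>) * (\<Prod>i\<in>{1..k} - {j}. (lam b k \<alpha> i x)\<^sup>2)" .
    have "lam_deg k \<alpha> = sig \<alpha> j + (\<Sum>i\<in>{1..k} - {j}. sig \<alpha> i - 1)"
      unfolding lam_deg_def using j by (subst sum.remove[of _ j]) auto
    then have 2: "exp (2 * lam_deg k \<alpha> * \<tau>) =
        exp (2 * (\<Sum>i\<in>{1..k} - {j}. sig \<alpha> i - 1) * \<tau>) * exp (2 * (sig \<alpha> j * \<tau>))"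
      by (simp add: exp_add[symmetric] algebra_simps)
    have 3: "(block_norm b j ?D)\<^sup>2 = exp (2 * (sig \<alpha> j * \<tau>)) * (block_norm b j x)\<^sup>2"
      by (simp add: block_norm_dil power_mult_distrib exp_double)
    show ?thesis unfolding 1 2 3 by (simp only: mult_ac)
  qed
  have "bracket_norm b k \<alpha> ?D = (exp (2 * lam_deg k \<alpha> * \<tau>) * (\<Sum>j=1..k.
      (\<Prod>i\<in>{1..k} - {j}. (lam b k \<alpha> i x)\<^sup>2) * (sig \<alpha> j)\<^sup>2 * (block_norm b j x)\<^sup>2)) powr (1 / (2 * lam_deg k \<alpha>))"
    unfolding bracket_norm_def sum_distrib_left by (intro arg_cong2[of _ _ _ _ "(powr)"] sum.cong refl *)
  also have "\<dots> = exp \<tau> * bracket_norm b k \<alpha> x"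
    unfolding bracket_norm_def using lam_deg_ge_1
    by (subst powr_mult) (auto intro!: sum_nonneg mult_nonneg_nonneg prod_nonneg simp: exp_powr_real)
  finally show ?thesis .
qed

lemma lam_pos:
  assumes "\<forall>i\<in>{1..k}. block_norm b i x > 0"
  shows "lam b k \<alpha> i x > 0"
  unfolding lam_def using assms by (intro prod_pos) (metis powr_gt_zero rpow_eq_powr less_irrefl)

text \<open>Exchanging the two products collects the column sums of \<alpha>, which are the
  exponents that \<open>hardy_psi\<close> subtracts, multiplied by p, from those of the
  blocks.\<close>

lemma prod_lam_eq:
  assumes "\<forall>i\<in>{1..k}. block_norm b i x > 0"
  shows "(\<Prod>j=1..k. lam b k \<alpha> j x) = (\<Prod>i=1..k. block_norm b i x powr (\<Sum>j=1..k. \<alpha> j i))"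
proof -
  have "(\<Prod>j=1..k. lam b k \<alpha> j x) = (\<Prod>j=1..k. \<Prod>i=1..k. block_norm b i x powr \<alpha> j i)"
    unfolding lam_def using assms by (intro prod.cong refl) (auto simp: rpow_eq_powr)
  also have "\<dots> = (\<Prod>i=1..k. \<Prod>j=1..k. block_norm b i x powr \<alpha> j i)"
    by (rule prod.swap)
  also have "\<dots> = (\<Prod>i=1..k. block_norm b i x powr (\<Sum>j=1..k. \<alpha> j i))"
    using assms by (intro prod.cong refl powr_sum[symmetric]) (metis less_irrefl)+
  finally show ?thesis .
qed

text \<open>A product over i \<noteq> j is the full product divided by its j-th factor, so the full
  product comes out of the sum. The remaining root is the first factor of the Cauchy-Schwarz
  inequality in \<open>abs_euler_le\<close>.\<close>

lemma bracket_norm_powr_deg: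
  assumes pos: "\<forall>i\<in>{1..k}. block_norm b i x > 0"
  shows "bracket_norm b k \<alpha> x powr lam_deg k \<alpha> =
    (\<Prod>i=1..k. lam b k \<alpha> i x) * sqrt (\<Sum>j=1..k. (sig \<alpha> j * block_norm b j x / lam b k \<alpha> j x)\<^sup>2)"
proof -
  let ?S = "\<Sum>j=1..k. (\<Prod>i\<in>{1..k} - {j}. (lam b k \<alpha> i x)\<^sup>2) * (sig \<alpha> j)\<^sup>2 * (block_norm b j x)\<^sup>2"
  have "(\<Prod>i\<in>{1..k} - {j}. (lam b k \<alpha> i x)\<^sup>2) * (sig \<alpha> j)\<^sup>2 * (block_norm b j x)\<^sup>2 =
      (\<Prod>i=1..k. lam b k \<alpha> i x)\<^sup>2 * (sig \<alpha> j * block_norm b j x / lam b k \<alpha> j x)\<^sup>2"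
    if j: "j \<in> {1..k}" for j
  proof -
    have "(\<Prod>i=1..k. lam b k \<alpha> i x) = lam b k \<alpha> j x * (\<Prod>i\<in>{1..k} - {j}. lam b k \<alpha> i x)"
      using j by (intro prod.remove) auto
    then show ?thesis
      using lam_pos[OF pos, of j] by (simp add: power_mult_distrib power_divide prod_power_distrib)
  qed
  then have S: "?S = (\<Prod>i=1..k. lam b k \<alpha> i x)\<^sup>2 * (\<Sum>j=1..k. (sig \<alpha> j * block_norm b j x / lam b k \<alpha> j x)\<^sup>2)"
    unfolding sum_distrib_left by (rule sum.cong[OF refl])
  have "bracket_norm b k \<alpha> x powr lam_deg k \<alpha> = ?S powr (1 / 2)"
    unfolding bracket_norm_def powr_powr using lam_deg_ge_1 by simp
  also have "\<dots> = sqrt ?S"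
    by (rule powr_half_sqrt) (intro sum_nonneg mult_nonneg_nonneg prod_nonneg; simp)
  also have "\<dots> = (\<Prod>i=1..k. lam b k \<alpha> i x) * sqrt (\<Sum>j=1..k. (sig \<alpha> j * block_norm b j x / lam b k \<alpha> j x)\<^sup>2)"
    unfolding S real_sqrt_mult using lam_pos[OF pos] by (simp add: prod_nonneg less_imp_le)
  finally show ?thesis .
qed

lemma bracket_norm_pos:
  assumes pos: "\<forall>i\<in>{1..k}. block_norm b i x > 0"
  shows "bracket_norm b k \<alpha> x > 0"
proof -
  have "(\<Sum>j=1..k. (sig \<alpha> j * block_norm b j x / lam b k \<alpha> j x)\<^sup>2) > 0"
  proof (rule sum_pos)
    show "(sig \<alpha> j * block_norm b j x / lam b k \<alpha> j x)\<^sup>2 > 0" if "j \<in> {1..k}" for j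
      using bspec[OF pos that] sig_pos[OF that] lam_pos[OF pos, of j] by simp
  qed (use k_ge_1 in auto)
  then have "bracket_norm b k \<alpha> x powr lam_deg k \<alpha> \<noteq> 0"
    unfolding bracket_norm_powr_deg[OF pos] using lam_pos[OF pos] by (simp add: less_imp_neq[symmetric])
  then show ?thesis by (simp add: bracket_norm_def less_le)
qed

text \<open>Each term of \<open>euler\<close> is multiplied and divided by the \<open>lam\<close> of
  its block before the Cauchy-Schwarz inequality is applied. Grouped by blocks, the first factor is
  the root in \<open>bracket_norm_powr_deg\<close>.\<close>

lemma abs_euler_le:
  assumes pos: "\<forall>i\<in>{1..k}. block_norm b i x > 0"
  shows "\<bar>euler (dil_exp b \<alpha>) \<phi> x\<bar> \<le>
    bracket_norm b k \<alpha> x powr lam_deg k \<alpha> / (\<Prod>i=1..k. lam b k \<alpha> i x) * norm (lam_gradient b k \<alpha> \<phi> x)"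
proof -
  let ?f = "\<lambda>m. sig \<alpha> (b m) * x $ m / lam b k \<alpha> (b m) x"
  have "\<bar>euler (dil_exp b \<alpha>) \<phi> x\<bar> = \<bar>\<Sum>m\<in>UNIV. ?f m * lam_gradient b k \<alpha> \<phi> x $ m\<bar>"
    unfolding euler_def lam_gradient_def
    by (intro arg_cong[of _ _ abs] sum.cong refl) (use lam_pos[OF pos] in \<open>simp add: less_imp_neq[symmetric]\<close>)
  also have "\<dots> \<le> (\<Sum>m\<in>UNIV. \<bar>?f m\<bar> * \<bar>lam_gradient b k \<alpha> \<phi> x $ m\<bar>)"
    by (rule order_trans[OF sum_abs]) (simp add: abs_mult)
  also have "\<dots> \<le> L2_set ?f UNIV * L2_set (\<lambda>m. lam_gradient b k \<alpha> \<phi> x $ m) UNIV"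
    by (rule L2_set_mult_ineq)
  also have "L2_set (\<lambda>m. lam_gradient b k \<alpha> \<phi> x $ m) UNIV = norm (lam_gradient b k \<alpha> \<phi> x)"
    by (simp add: norm_vec_def L2_set_def)
  also have "L2_set ?f UNIV = sqrt (\<Sum>j=1..k. (sig \<alpha> j * block_norm b j x / lam b k \<alpha> j x)\<^sup>2)"
  proof -
    have "(\<Sum>m\<in>{m. b m = j}. (?f m)\<^sup>2) = (sig \<alpha> j * block_norm b j x / lam b k \<alpha> j x)\<^sup>2" for j
    proof -
      have "(\<Sum>m\<in>{m. b m = j}. (?f m)\<^sup>2) = (\<Sum>m\<in>{m. b m = j}. (sig \<alpha> j / lam b k \<alpha> j x)\<^sup>2 * (x $ m)\<^sup>2)"
        by (intro sum.cong refl) (auto simp: power_mult_distrib power_divide)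
      also have "\<dots> = (sig \<alpha> j / lam b k \<alpha> j x)\<^sup>2 * (block_norm b j x)\<^sup>2"
        by (simp add: block_norm_def L2_set_def sum_nonneg sum_distrib_left)
      finally show ?thesis by (simp add: power_mult_distrib power_divide)
    qed
    then show ?thesis unfolding L2_set_def sum_by_blocks by simp
  qed
  also have "\<dots> = bracket_norm b k \<alpha> x powr lam_deg k \<alpha> / (\<Prod>i=1..k. lam b k \<alpha> i x)"
    unfolding bracket_norm_powr_deg[OF pos] using lam_pos[OF pos] by (simp add: less_imp_neq[symmetric])
  finally show ?thesis .
qed

text \<open>The two norms differ only in constants c_j multiplying the block norms, 1 or \<sigma>_j,
  so measurability and homogeneity can be proved for both at once.\<close>

lemma hnorm_cases:
  assumes "nrm = hnorm1 b k \<alpha> \<or> nrm = hnorm2 b k \<alpha>"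
  obtains c where "\<And>j. j \<in> {1..k} \<Longrightarrow> c j > 0"
    "nrm = (\<lambda>x. (\<Sum>j=1..k. (c j * block_norm b j x) powr (2 * (\<Prod>i\<in>{1..k} - {j}. sig \<alpha> i)))
       powr (1 / (2 * (\<Prod>i=1..k. sig \<alpha> i))))"
  using assms
proof
  assume "nrm = hnorm1 b k \<alpha>"
  then show thesis by (intro that[of "\<lambda>_. 1"]) (auto simp: hnorm1_def)
next
  assume "nrm = hnorm2 b k \<alpha>"
  then show thesis by (intro that[of "sig \<alpha>"]) (auto simp: hnorm2_def sig_pos)
qed

section \<open>The Hardy inequality for the weights\<close>

context
  fixes nrm :: "real ^ 'n \<Rightarrow> real"
  assumes nrm: "nrm = hnorm1 b k \<alpha> \<or> nrm = hnorm2 b k \<alpha>"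
begin

lemma hnorm_nonneg: "nrm x \<ge> 0"
  using nrm by (auto simp: hnorm1_def hnorm2_def)

lemma borel_measurable_hnorm [measurable]: "nrm \<in> borel_measurable borel"
proof -
  obtain c where "nrm = (\<lambda>x. (\<Sum>j=1..k. (c j * block_norm b j x) powr (2 * (\<Prod>i\<in>{1..k} - {j}. sig \<alpha> i)))
       powr (1 / (2 * (\<Prod>i=1..k. sig \<alpha> i))))"
    using hnorm_cases[OF nrm] by blast
  then show ?thesis by simp
qed

text \<open>The degree \<sigma>_j of a block times its exponent is twice the product of all
  \<sigma>_i, whatever j is; the outer root undoes it.\<close>

lemma hnorm_dil: "nrm (dil (dil_exp b \<alpha>) \<tau> x) = exp \<tau> * nrm x"
proof -
  define P where "P = (\<Prod>i=1..k. sig \<alpha> i)"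
  have P: "P > 0" unfolding P_def by (intro prod_pos) (auto simp: sig_pos)
  obtain c where c: "\<And>j. j \<in> {1..k} \<Longrightarrow> c j > 0"
    and eq: "nrm = (\<lambda>x. (\<Sum>j=1..k. (c j * block_norm b j x) powr (2 * (\<Prod>i\<in>{1..k} - {j}. sig \<alpha> i)))
       powr (1 / (2 * P)))"
    unfolding P_def using hnorm_cases[OF nrm] by blast
  have *: "(c j * block_norm b j (dil (dil_exp b \<alpha>) \<tau> x)) powr (2 * (\<Prod>i\<in>{1..k} - {j}. sig \<alpha> i)) =
      exp (2 * P * \<tau>) * (c j * block_norm b j x) powr (2 * (\<Prod>i\<in>{1..k} - {j}. sig \<alpha> i))"
    if j: "j \<in> {1..k}" for j
  proof -
    have "P = sig \<alpha> j * (\<Prod>i\<in>{1..k} - {j}. sig \<alpha> i)"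
      unfolding P_def using j by (subst prod.remove[of _ j]) auto
    then show ?thesis using c[OF j]
      by (simp add: block_norm_dil powr_mult exp_powr_real mult_ac)
  qed
  have "nrm (dil (dil_exp b \<alpha>) \<tau> x) =
      (exp (2 * P * \<tau>) * (\<Sum>j=1..k. (c j * block_norm b j x) powr (2 * (\<Prod>i\<in>{1..k} - {j}. sig \<alpha> i))))
       powr (1 / (2 * P))"
    unfolding eq sum_distrib_left by (intro arg_cong2[of _ _ _ _ "(powr)"] sum.cong refl *)
  also have "\<dots> = exp \<tau> * nrm x"
    unfolding eq using P by (subst powr_mult) (auto intro: sum_nonneg simp: exp_powr_real)
  finally show ?thesis .
qed

lemma hardy_weight_nonneg: "hardy_weight b k \<alpha> nrm \<mu> s t x \<ge> 0"
  unfolding hardy_weight_def by (intro divide_nonneg_nonneg prod_nonneg mult_nonneg_nonneg) auto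

lemma hardy_psi_nonneg: "hardy_psi b k \<alpha> nrm p \<mu> s t x \<ge> 0"
  unfolding hardy_psi_def by (intro divide_nonneg_nonneg prod_nonneg mult_nonneg_nonneg) auto

lemma borel_measurable_hardy_weight [measurable]:
  "hardy_weight b k \<alpha> nrm \<mu> s t \<in> borel_measurable borel"
  unfolding hardy_weight_def by measurable

lemma borel_measurable_hardy_psi [measurable]:
  "hardy_psi b k \<alpha> nrm p \<mu> s t \<in> borel_measurable borel"
  unfolding hardy_psi_def by measurable

text \<open>This degree plays the part of \<open>d\<close> in \<open>hardy_euler\<close>; added to
  the Jacobian exponent \<open>hom_dim\<close> it gives \<open>hardy_num\<close>.\<close>

lemma hardy_weight_dil:
  "hardy_weight b k \<alpha> nrm \<mu> s t (dil (dil_exp b \<alpha>) \<tau> x) =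
    exp (((\<Sum>i=1..k. sig \<alpha> i * \<mu> i) - s - t) * \<tau>) * hardy_weight b k \<alpha> nrm \<mu> s t x"
proof -
  have bracket_nonneg: "bracket_norm b k \<alpha> x \<ge> 0" by (simp add: bracket_norm_def)
  have E: "(\<Sum>i=1..k. \<mu> i * (sig \<alpha> i * \<tau>)) = (\<Sum>i=1..k. sig \<alpha> i * \<mu> i) * \<tau>"
    by (simp add: sum_distrib_left mult_ac)
  have "(\<Prod>i=1..k. rpow (block_norm b i (dil (dil_exp b \<alpha>) \<tau> x)) (\<mu> i)) =
      exp ((\<Sum>i=1..k. sig \<alpha> i * \<mu> i) * \<tau>) * (\<Prod>i=1..k. rpow (block_norm b i x) (\<mu> i))"
    by (simp add: block_norm_dil rpow_exp_mult prod.distrib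
        exp_sum[symmetric] E[simplified])
  then show ?thesis
    by (simp add: hardy_weight_def hnorm_dil bracket_norm_dil rpow_exp_mult hnorm_nonneg bracket_nonneg
        left_diff_distrib exp_diff)
qed


text \<open>On positive bases the exponents in \<open>hardy_psi\<close> can be split; the column
  sums then reassemble to the product of the \<open>lam\<close> by \<open>prod_lam_eq\<close>. The
  last factor is the p-th power of the one in \<open>abs_euler_le\<close>.\<close>

lemma hardy_psi_eq:
  assumes pos: "\<forall>i\<in>{1..k}. block_norm b i x > 0"
  shows "hardy_psi b k \<alpha> nrm p \<mu> s t x = hardy_weight b k \<alpha> nrm \<mu> s t x *
    (bracket_norm b k \<alpha> x powr lam_deg k \<alpha> / (\<Prod>i=1..k. lam b k \<alpha> i x)) powr p"
proof -
  have "(\<Prod>i=1..k. rpow (block_norm b i x) (\<mu> i - p * (\<Sum>j=1..k. \<alpha> j i))) =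
      (\<Prod>i=1..k. rpow (block_norm b i x) (\<mu> i) / (block_norm b i x powr (\<Sum>j=1..k. \<alpha> j i)) powr p)"
    using pos by (intro prod.cong refl) (simp add: rpow_eq_powr powr_diff powr_powr mult.commute)
  also have "\<dots> = (\<Prod>i=1..k. rpow (block_norm b i x) (\<mu> i)) / (\<Prod>i=1..k. lam b k \<alpha> i x) powr p"
    by (simp add: prod_dividef prod_powr_distrib prod_lam_eq[OF pos, simplified])
  finally show ?thesis
    using bracket_norm_pos[OF pos] lam_pos[OF pos]
    by (simp add: hardy_psi_def hardy_weight_def rpow_eq_powr powr_diff powr_divide powr_powr prod_nonneg
        less_imp_le mult.commute)
qed

lemma hardy_weight_euler_le:
  assumes pos: "\<forall>i\<in>{1..k}. block_norm b i x > 0" and p: "p > 1"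
  shows "hardy_weight b k \<alpha> nrm \<mu> s t x * \<bar>euler (dil_exp b \<alpha>) \<phi> x\<bar> powr p
    \<le> hardy_psi b k \<alpha> nrm p \<mu> s t x * norm (lam_gradient b k \<alpha> \<phi> x) powr p"
proof -
  let ?r = "bracket_norm b k \<alpha> x powr lam_deg k \<alpha> / (\<Prod>i=1..k. lam b k \<alpha> i x)"
  have "\<bar>euler (dil_exp b \<alpha>) \<phi> x\<bar> powr p \<le> (?r * norm (lam_gradient b k \<alpha> \<phi> x)) powr p"
    using p by (intro powr_mono2 abs_euler_le pos) auto
  also have "\<dots> = ?r powr p * norm (lam_gradient b k \<alpha> \<phi> x) powr p"
    by (rule powr_mult)
  finally have "hardy_weight b k \<alpha> nrm \<mu> s t x * \<bar>euler (dil_exp b \<alpha>) \<phi> x\<bar> powr p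
      \<le> hardy_weight b k \<alpha> nrm \<mu> s t x * (?r powr p * norm (lam_gradient b k \<alpha> \<phi> x) powr p)"
    by (rule mult_left_mono) (rule hardy_weight_nonneg)
  then show ?thesis by (simp only: hardy_psi_eq[OF pos] mult.assoc)
qed

text \<open>Combines \<open>hardy_euler\<close> on the whole space with the pointwise bound
  \<open>hardy_weight_euler_le\<close> off the null set of vanishing blocks. The support of \<phi>
  turns whole-space integrals into integrals over \<Omega>.\<close>

lemma hardy_C01:
  assumes \<Omega>: "open \<Omega>" and p: "p > 1" and H: "hardy_num b k \<alpha> \<mu> s t > 0" and \<phi>: "\<phi> \<in> C01 \<Omega>"
  shows "ennreal ((hardy_num b k \<alpha> \<mu> s t / p) powr p) *
      (\<integral>\<^sup>+x. ennreal (hardy_weight b k \<alpha> nrm \<mu> s t x * \<bar>\<phi> x\<bar> powr p) \<partial>lebesgue_on \<Omega>)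
    \<le> (\<integral>\<^sup>+x. ennreal (hardy_psi b k \<alpha> nrm p \<mu> s t x * norm (lam_gradient b k \<alpha> \<phi> x) powr p) \<partial>lebesgue_on \<Omega>)"
proof -
  let ?w = "hardy_weight b k \<alpha> nrm \<mu> s t" and ?E = "euler (dil_exp b \<alpha>) \<phi>"
  have \<phi>': "\<phi> differentiable_on UNIV" "continuous_on UNIV (gradient \<phi>)"
    "compact (closure {x. \<phi> x \<noteq> 0})" "closure {x. \<phi> x \<noteq> 0} \<subseteq> \<Omega>"
    using \<phi> by (auto simp: C01_def)
  have bdd: "bounded {x. \<phi> x \<noteq> 0}"
    using \<phi>'(3) compact_imp_bounded bounded_subset closure_subset by blast
  \<comment> \<open>A point outside \<Omega> has a neighbourhood off the closed support on which
    \<phi> is identically 0, so its derivative vanishes there too.\<close>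
  have E0: "?E x = 0" if "x \<notin> \<Omega>" for x
  proof -
    let ?U = "- closure {x. \<phi> x \<noteq> 0}"
    have x: "x \<in> ?U" using \<phi>'(4) that by auto
    have "(\<phi> has_derivative (\<lambda>_. 0)) (at x)"
    proof (rule has_derivative_transform_within_open[OF _ _ x])
      show "((\<lambda>_. 0) has_derivative (\<lambda>_. 0)) (at x)" by simp
      show "0 = \<phi> y" if "y \<in> ?U" for y using that closure_subset[of "{x. \<phi> x \<noteq> 0}"] by auto
    qed auto
    then have "frechet_derivative \<phi> (at x) = (\<lambda>_. 0)"
      by (rule frechet_derivative_at[symmetric])
    then show ?thesis by (simp add: euler_def gradient_def)
  qed
  have "ennreal ((hardy_num b k \<alpha> \<mu> s t / p) powr p) * (\<integral>\<^sup>+x. ennreal (?w x * \<bar>\<phi> x\<bar> powr p) \<partial>lborel)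
      \<le> (\<integral>\<^sup>+x. ennreal (?w x * \<bar>?E x\<bar> powr p) \<partial>lborel)"
    by (rule hardy_euler[OF p, where d = "(\<Sum>i=1..k. sig \<alpha> i * \<mu> i) - s - t"])
      (use H \<phi>' bdd in \<open>simp_all add: dil_exp_pos hardy_weight_nonneg hardy_weight_dil hardy_num_def hom_dim_eq\<close>)
  also have "\<dots> \<le> (\<integral>\<^sup>+x. ennreal (hardy_psi b k \<alpha> nrm p \<mu> s t x * norm (lam_gradient b k \<alpha> \<phi> x) powr p)
      * indicator \<Omega> x \<partial>lborel)"
  proof -
    have "AE x in lebesgue. ennreal (?w x * \<bar>?E x\<bar> powr p) \<le>
        ennreal (hardy_psi b k \<alpha> nrm p \<mu> s t x * norm (lam_gradient b k \<alpha> \<phi> x) powr p) * indicator \<Omega> x"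
      using AE_block_norm_pos[OF range_b]
    proof eventually_elim
      case (elim x)
      then show ?case
        using hardy_weight_euler_le[OF _ p, of x] E0[of x] p by (auto simp: indicator_def intro!: ennreal_leI)
    qed
    \<comment> \<open>The exceptional set is null for the completed measure, so the
      \<open>lborel\<close> integrals are first rewritten as \<open>lebesgue\<close> ones.\<close>
    then show ?thesis
      unfolding nn_integral_completion[of lborel, symmetric] by (rule nn_integral_mono_AE)
  qed
  also have "\<dots> = (\<integral>\<^sup>+x. ennreal (hardy_psi b k \<alpha> nrm p \<mu> s t x * norm (lam_gradient b k \<alpha> \<phi> x) powr p) \<partial>lebesgue_on \<Omega>)"
    by (rule nn_integral_lebesgue_on[OF \<Omega>, symmetric])
  also have "(\<integral>\<^sup>+x. ennreal (?w x * \<bar>\<phi> x\<bar> powr p) \<partial>lborel) = (\<integral>\<^sup>+x. ennreal (?w x * \<bar>\<phi> x\<bar> powr p) \<partial>lebesgue_on \<Omega>)"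
  proof -
    have "\<phi> x = 0" if "x \<notin> \<Omega>" for x using that \<phi>'(4) closure_subset[of "{x. \<phi> x \<noteq> 0}"] by auto
    then show ?thesis
      unfolding nn_integral_lebesgue_on[OF \<Omega>] using p by (intro nn_integral_cong) (auto simp: indicator_def)
  qed
  finally show ?thesis .
qed

lemma hardy_W0:
  assumes \<Omega>: "open \<Omega>" and p: "p > 1" and H: "hardy_num b k \<alpha> \<mu> s t \<ge> 0"
    and G: "has_W0_gradient b k \<alpha> \<Omega> p (hardy_psi b k \<alpha> nrm p \<mu> s t) u G"
  shows "ennreal ((hardy_num b k \<alpha> \<mu> s t / p) powr p) *
      (\<integral>\<^sup>+x. ennreal (hardy_weight b k \<alpha> nrm \<mu> s t x * \<bar>u x\<bar> powr p) \<partial>lebesgue_on \<Omega>)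
    \<le> (\<integral>\<^sup>+x. ennreal (hardy_psi b k \<alpha> nrm p \<mu> s t x * norm (G x) powr p) \<partial>lebesgue_on \<Omega>)"
proof (cases "hardy_num b k \<alpha> \<mu> s t = 0")
  \<comment> \<open>Here the constant is 0 powr p = 0, and in \<open>ennreal\<close> its product
    with a possibly infinite integral is 0. The remaining case has the strict positivity that
    \<open>hardy_C01\<close> asks for.\<close>
  case True
  then show ?thesis by simp
next
  case False
  let ?w = "hardy_weight b k \<alpha> nrm \<mu> s t" and ?\<psi> = "hardy_psi b k \<alpha> nrm p \<mu> s t"
  define C where "C = (hardy_num b k \<alpha> \<mu> s t / p) powr p"
  have C: "C \<ge> 0" by (simp add: C_def)
  have meas: "f \<in> borel_measurable (lebesgue_on \<Omega>)" if "f \<in> borel_measurable borel"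
    for f :: "real ^ 'n \<Rightarrow> 'c::topological_space"
    using that by (intro measurable_restrict_space1 measurable_completion) simp
  obtain \<phi> where \<phi>: "\<And>n. \<phi> n \<in> C01 \<Omega>"
    and \<phi>_u: "AE x in lebesgue_on \<Omega>. (\<lambda>n. \<phi> n x) \<longlonglongrightarrow> u x"
    and \<phi>_G: "(\<lambda>n. Lp_energy \<Omega> p ?\<psi> (\<lambda>x. lam_gradient b k \<alpha> (\<phi> n) x - G x)) \<longlonglongrightarrow> 0"
    using G unfolding has_W0_gradient_def by blast
  have G_meas: "G \<in> borel_measurable (lebesgue_on \<Omega>)"
    using G by (simp add: has_W0_gradient_def)
  have \<phi>_cont: "continuous_on UNIV (\<phi> n)" "continuous_on UNIV (gradient (\<phi> n))" for n
    using \<phi>[of n] by (auto simp: C01_def intro: differentiable_imp_continuous_on)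
  have lg_meas: "lam_gradient b k \<alpha> (\<phi> n) \<in> borel_measurable borel" for n
  proof -
    have [measurable]: "(\<lambda>x. gradient (\<phi> n) x $ m) \<in> borel_measurable borel" for m
      by (intro borel_measurable_continuous_onI continuous_intros \<phi>_cont)
    have "(\<lambda>x. lam_gradient b k \<alpha> (\<phi> n) x \<bullet> i) \<in> borel_measurable borel" if "i \<in> Basis" for i
    proof -
      obtain m where "i = axis m 1" using \<open>i \<in> Basis\<close> by (auto simp: Basis_vec_def)
      then show ?thesis by (simp add: lam_gradient_def inner_axis)
    qed
    then show ?thesis by (subst borel_measurable_euclidean_space) blast
  qed
  \<comment> \<open>\<open>Lp_inequality_closure\<close> compares the integrals with constant 1, so
    the Hardy constant is moved into the left weight.\<close>
  have absorb: "ennreal C * (\<integral>\<^sup>+x. ennreal (?w x * \<bar>v x\<bar> powr p) \<partial>lebesgue_on \<Omega>)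
      = (\<integral>\<^sup>+x. ennreal (C * ?w x * \<bar>v x\<bar> powr p) \<partial>lebesgue_on \<Omega>)"
    if [measurable]: "v \<in> borel_measurable (lebesgue_on \<Omega>)" for v
  proof -
    have [measurable]: "?w \<in> borel_measurable (lebesgue_on \<Omega>)" by (rule meas) measurable
    show ?thesis
      using C hardy_weight_nonneg by (simp add: nn_integral_cmult[symmetric] ennreal_mult mult.assoc)
  qed
  \<comment> \<open>A representative of \<open>u\<close> whose measurability comes directly from
    that of the \<phi> n, as \<open>absorb\<close> demands.\<close>
  define v where "v x = lim (\<lambda>n. \<phi> n x)" for x
  have v_meas: "v \<in> borel_measurable (lebesgue_on \<Omega>)"
    unfolding v_def by (intro borel_measurable_lim_metric meas borel_measurable_continuous_onI \<phi>_cont)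
  have uv: "AE x in lebesgue_on \<Omega>. u x = v x"
    using \<phi>_u by eventually_elim (simp add: v_def limI)
  have \<phi>_v: "AE x in lebesgue_on \<Omega>. (\<lambda>n. \<phi> n x) \<longlonglongrightarrow> v x"
    using \<phi>_u uv by eventually_elim simp
  have "(\<integral>\<^sup>+x. ennreal (C * ?w x * \<bar>v x\<bar> powr p) \<partial>lebesgue_on \<Omega>)
      \<le> (\<integral>\<^sup>+x. ennreal (?\<psi> x * norm (G x) powr p) \<partial>lebesgue_on \<Omega>)"
  proof (rule Lp_inequality_closure[OF p _ _ G_meas _ _ _ _ _ \<phi>_v \<phi>_G[unfolded Lp_energy_def]])
    show "(\<lambda>x. C * ?w x) \<in> borel_measurable (lebesgue_on \<Omega>)" by (rule meas) measurable
    show "?\<psi> \<in> borel_measurable (lebesgue_on \<Omega>)" by (rule meas) measurable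
    show \<phi>_meas: "\<phi> n \<in> borel_measurable (lebesgue_on \<Omega>)" for n
      by (intro meas borel_measurable_continuous_onI \<phi>_cont)
    show "lam_gradient b k \<alpha> (\<phi> n) \<in> borel_measurable (lebesgue_on \<Omega>)" for n
      by (intro meas lg_meas)
    show "(\<integral>\<^sup>+x. ennreal (C * ?w x * \<bar>\<phi> n x\<bar> powr p) \<partial>lebesgue_on \<Omega>)
        \<le> (\<integral>\<^sup>+x. ennreal (?\<psi> x * norm (lam_gradient b k \<alpha> (\<phi> n) x) powr p) \<partial>lebesgue_on \<Omega>)" for n
      unfolding absorb[OF \<phi>_meas, symmetric] unfolding C_def
      using H False by (intro hardy_C01 \<Omega> p \<phi>) auto
  qed (use C in \<open>auto simp: hardy_weight_nonneg hardy_psi_nonneg\<close>)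
  moreover have "(\<integral>\<^sup>+x. ennreal (?w x * \<bar>u x\<bar> powr p) \<partial>lebesgue_on \<Omega>)
      = (\<integral>\<^sup>+x. ennreal (?w x * \<bar>v x\<bar> powr p) \<partial>lebesgue_on \<Omega>)"
    using uv by (intro nn_integral_cong_AE) auto
  ultimately show ?thesis unfolding absorb[OF v_meas, symmetric] by (simp add: C_def)
qed

lemma hardy_psi_special:
  assumes pos: "\<forall>i\<in>{1..k}. block_norm b i x > 0" and "p > 1"
  shows "hardy_psi b k \<alpha> nrm p (\<lambda>_. 0) 0 p x =
    bracket_norm b k \<alpha> x powr (p * lam_deg k \<alpha>) / (nrm x powr p * (\<Prod>j=1..k. lam b k \<alpha> j x powr p))"
  using assms lam_pos[OF pos]
  by (simp add: hardy_psi_eq[OF pos] hardy_weight_def rpow_def powr_divide powr_powr prod_powr_distrib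
      less_imp_le mult.commute)

end

end

section \<open>The general inequality and its special case\<close>

theorem theorem2:
  fixes b :: "'n::finite \<Rightarrow> nat" and k :: nat and \<alpha> :: "nat \<Rightarrow> nat \<Rightarrow> real"
    and \<Omega> :: "(real ^ 'n) set" and nrm :: "real ^ 'n \<Rightarrow> real" and p :: real
  assumes "CARD('n) \<ge> 3"
    and "lam_system b k \<alpha>"
    and "open \<Omega>"
    and "nrm = hnorm1 b k \<alpha> \<or> nrm = hnorm2 b k \<alpha>"
    and "p > 1"
  shows
    "(\<forall>(\<mu> :: nat \<Rightarrow> real) (s :: real) (t :: real).
        hardy_admissible b k \<alpha> p \<mu> s t \<longrightarrow>
        0 \<le> hardy_num b k \<alpha> \<mu> s t \<longrightarrow>
        (\<forall>u \<in> W0 b k \<alpha> \<Omega> p (hardy_psi b k \<alpha> nrm p \<mu> s t).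
         \<forall>G. has_W0_gradient b k \<alpha> \<Omega> p (hardy_psi b k \<alpha> nrm p \<mu> s t) u G \<longrightarrow>
           ennreal ((hardy_num b k \<alpha> \<mu> s t / p) powr p) *
             (\<integral>\<^sup>+x. ennreal (hardy_weight b k \<alpha> nrm \<mu> s t x * \<bar>u x\<bar> powr p) \<partial>lebesgue_on \<Omega>)
           \<le> (\<integral>\<^sup>+x. ennreal (hardy_psi b k \<alpha> nrm p \<mu> s t x * norm (G x) powr p) \<partial>lebesgue_on \<Omega>)))
     \<and>
     (hardy_admissible b k \<alpha> p (\<lambda>_. 0) 0 p \<longrightarrow>
        (\<forall>u \<in> W0 b k \<alpha> \<Omega> p (hardy_psi b k \<alpha> nrm p (\<lambda>_. 0) 0 p).
         \<forall>G. has_W0_gradient b k \<alpha> \<Omega> p (hardy_psi b k \<alpha> nrm p (\<lambda>_. 0) 0 p) u G \<longrightarrow>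
           ennreal (((hom_dim b k \<alpha> - p) / p) powr p) *
             (\<integral>\<^sup>+x. ennreal (\<bar>u x\<bar> powr p / nrm x powr p) \<partial>lebesgue_on \<Omega>)
           \<le> (\<integral>\<^sup>+x. ennreal (bracket_norm b k \<alpha> x powr (p * lam_deg k \<alpha>)
                               / (nrm x powr p * (\<Prod>j=1..k. lam b k \<alpha> j x powr p))
                               * norm (G x) powr p) \<partial>lebesgue_on \<Omega>)))"
proof (intro conjI allI impI ballI)
  note sys = assms(2) and nrm = assms(4) and p = assms(5)
  show "ennreal ((hardy_num b k \<alpha> \<mu> s t / p) powr p) *
      (\<integral>\<^sup>+x. ennreal (hardy_weight b k \<alpha> nrm \<mu> s t x * \<bar>u x\<bar> powr p) \<partial>lebesgue_on \<Omega>)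
    \<le> (\<integral>\<^sup>+x. ennreal (hardy_psi b k \<alpha> nrm p \<mu> s t x * norm (G x) powr p) \<partial>lebesgue_on \<Omega>)"
    if "0 \<le> hardy_num b k \<alpha> \<mu> s t" "has_W0_gradient b k \<alpha> \<Omega> p (hardy_psi b k \<alpha> nrm p \<mu> s t) u G"
    for \<mu> s t u G
    using hardy_W0[OF sys nrm assms(3) p] that .
next
  note sys = assms(2) and nrm = assms(4) and p = assms(5)
  fix u :: "real ^ 'n \<Rightarrow> real" and G
  assume adm: "hardy_admissible b k \<alpha> p (\<lambda>_. 0) 0 p"
    and G: "has_W0_gradient b k \<alpha> \<Omega> p (hardy_psi b k \<alpha> nrm p (\<lambda>_. 0) 0 p) u G"
  have num: "hardy_num b k \<alpha> (\<lambda>_. 0) 0 p = hom_dim b k \<alpha> - p"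
    by (simp add: hardy_num_def)
  \<comment> \<open>With s = 0, t = p and \<mu> = 0 the first admissibility condition reads p < N_1
    \<le> Q, so the sign condition on the numerator holds automatically.\<close>
  have "p < real (block_dim b 1)" using adm by (simp add: hardy_admissible_def)
  then have "hardy_num b k \<alpha> (\<lambda>_. 0) 0 p \<ge> 0"
    using block_dim_1_le_hom_dim[OF sys] by (simp add: num)
  note hardy_W0[OF sys nrm assms(3) p this G]
  \<comment> \<open>This identity holds at every point: \<open>rpow\<close> is 1 at exponent 0, and
    it is \<open>powr\<close> at the exponent p > 0.\<close>
  moreover have "hardy_weight b k \<alpha> nrm (\<lambda>_. 0) 0 p x * \<bar>u x\<bar> powr p = \<bar>u x\<bar> powr p / nrm x powr p" for x
    using p by (simp add: hardy_weight_def rpow_def)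
  moreover have "(\<integral>\<^sup>+x. ennreal (hardy_psi b k \<alpha> nrm p (\<lambda>_. 0) 0 p x * norm (G x) powr p) \<partial>lebesgue_on \<Omega>)
      = (\<integral>\<^sup>+x. ennreal (bracket_norm b k \<alpha> x powr (p * lam_deg k \<alpha>)
          / (nrm x powr p * (\<Prod>j=1..k. lam b k \<alpha> j x powr p)) * norm (G x) powr p) \<partial>lebesgue_on \<Omega>)"
  \<comment> \<open>The two forms of \<psi> are compared only where all blocks are nonzero, hence
    almost everywhere.\<close>
  proof (rule nn_integral_cong_AE)
    have "\<Omega> \<in> sets lebesgue" using assms(3) by (intro sets_completionI_sets) simp
    then have "AE x in lebesgue_on \<Omega>. \<forall>i\<in>{1..k}. block_norm b i x > 0"
      using AE_block_norm_pos[OF range_b[OF sys]] by (subst AE_restrict_space_iff) auto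
    then show "AE x in lebesgue_on \<Omega>. ennreal (hardy_psi b k \<alpha> nrm p (\<lambda>_. 0) 0 p x * norm (G x) powr p) =
        ennreal (bracket_norm b k \<alpha> x powr (p * lam_deg k \<alpha>)
          / (nrm x powr p * (\<Prod>j=1..k. lam b k \<alpha> j x powr p)) * norm (G x) powr p)"
      by eventually_elim (simp only: hardy_psi_special[OF sys nrm _ p])
  qed
  ultimately show "ennreal (((hom_dim b k \<alpha> - p) / p) powr p) *
        (\<integral>\<^sup>+x. ennreal (\<bar>u x\<bar> powr p / nrm x powr p) \<partial>lebesgue_on \<Omega>)
      \<le> (\<integral>\<^sup>+x. ennreal (bracket_norm b k \<alpha> x powr (p * lam_deg k \<alpha>)
          / (nrm x powr p * (\<Prod>j=1..k. lam b k \<alpha> j x powr p)) * norm (G x) powr p) \<partial>lebesgue_on \<Omega>)"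
    by (simp only: num)
qed

end
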